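(* Let $D_1$ and $D_2$ be two chord diagrams with the same intersection graph, $\Gamma(D_1)=\Gamma(D_2)=\Gamma$ (equality meaning isomorphism of graphs). Suppose $\Gamma$ has at most one loop, i.e. $\pi_1(\Gamma)=\mathbf{Z}$ or $0$. Then for any weight system $W$, $W(D_1)=W(D_2)$.
   Context: A chord diagram of degree $n$ is an oriented circle together with $n$ chords whose $2n$ endpoints are distinct points of the circle; it is determined by the cyclic order of the $2n$ endpoints and their pairing (diagrams are considered up to orientation-preserving homeomorphism of the circle). Two chords intersect if their endpoints alternate along the circle. The intersection graph $\Gamma(D)$ of a chord diagram $D$ is the simple graph with one vertex for each chord of $D$, two vertices being joined by an edge if and only if the corresponding chords intersect. A loop of a graph means a cycle, so "at most one loop" means that the graph contains at most one cycle; $\pi_1$ denotes the fundamental group of the graph regarded as a 1-dimensional complex. Let $\mathbf{K}$ be an (arbitrary) associative commutative ring with unity. A weight system of degree $n$ is a $\mathbf{K}$-valued linear functional $W$ on the space of chord diagrams of degree $n$ satisfying: (1-term relation) $W(D)=0$ whenever $D$ has an isolated chord, i.e. a chord intersecting no other chord; (4-term relation) let $D'$ be a chord diagram of degree $n-1$, $a$ a chord of $D'$ with endpoints $p,q$, and $r$ a point of the circle that is not an endpoint of a chord. For $s\in\{p,q\}$ let $D_{s-}$ (resp. $D_{s+}$) be the diagram obtained from $D'$ by adding a chord joining $r$ to a point immediately before (resp. immediately after) $s$ with respect to the orientation of the circle. Then $W(D_{p-})-W(D_{p+})+W(D_{q-})-W(D_{q+})=0$. *)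

theory Defs
  imports Main "HOL-Library.Poly_Mapping"
begin

section \<open>Chord diagrams\<close>

text \<open>
  Cutting the circle at a point that is not an endpoint and reading off the chords met along the
  orientation turns a chord diagram into a word in which every letter occurs exactly twice. The
  letters are arbitrary names of the chords, and the cut point is arbitrary as well, so that words
  are identified up to renaming of letters and rotation.
\<close>

definition gauss_word :: "nat list \<Rightarrow> bool" where
  "gauss_word w \<longleftrightarrow> (\<forall>a \<in> set w. count_list w a = 2)"

definition word_equiv :: "nat list \<Rightarrow> nat list \<Rightarrow> bool" where
  "word_equiv w w' \<longleftrightarrow> gauss_word w \<and> gauss_word w' \<and>
     (\<exists>f k. inj_on f (set w) \<and> w' = rotate k (map f w))"

lemma rotate_inverse: "\<exists>k'. rotate k' (rotate k w) = w"
proof (cases "w = []")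
  case False
  then have "k * length w - k + k = k * length w"
    by (cases "length w") auto
  then have "rotate (k * length w - k) (rotate k w) = w"
    by (simp add: rotate_rotate rotate_id)
  then show ?thesis ..
qed simp

lemma word_equiv_refl: "gauss_word w \<Longrightarrow> word_equiv w w"
  unfolding word_equiv_def by (intro conjI exI[of _ id] exI[of _ 0]) auto

lemma word_equiv_sym:
  assumes "word_equiv w w'"
  shows "word_equiv w' w"
proof -
  obtain f k where f: "inj_on f (set w)" and w': "w' = rotate k (map f w)"
    using assms by (auto simp: word_equiv_def)
  obtain k' where k': "rotate k' (rotate k w) = w"
    using rotate_inverse by blast
  let ?g = "inv_into (set w) f"
  have "map ?g (map f w) = w"
    using f by (simp add: map_idI)
  then have "w = rotate k' (map ?g w')"
    using k' by (simp only: w' rotate_map)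
  moreover have "inj_on ?g (set w')"
    by (simp add: w' inj_on_inv_into)
  moreover have "gauss_word w" "gauss_word w'"
    using assms by (auto simp: word_equiv_def)
  ultimately show ?thesis
    unfolding word_equiv_def by blast
qed

lemma word_equiv_trans:
  assumes "word_equiv u v" "word_equiv v w"
  shows "word_equiv u w"
proof -
  obtain f k where f: "inj_on f (set u)" and v: "v = rotate k (map f u)"
    using assms by (auto simp: word_equiv_def)
  obtain g l where g: "inj_on g (set v)" and w: "w = rotate l (map g v)"
    using assms by (auto simp: word_equiv_def)
  have "inj_on (g \<circ> f) (set u)"
    using f g by (simp add: v comp_inj_on)
  moreover have "w = rotate (l + k) (map (g \<circ> f) u)"
    by (simp add: w v rotate_map rotate_rotate)
  moreover have "gauss_word u" "gauss_word w"
    using assms by (auto simp: word_equiv_def)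
  ultimately show ?thesis
    unfolding word_equiv_def by blast
qed

quotient_type chord_diagram = "nat list" / partial: word_equiv
  morphisms some_word diagram
proof (rule part_equivpI)
  show "\<exists>w. word_equiv w w"
    by (rule exI[of _ "[]"], rule word_equiv_refl) (simp add: gauss_word_def)
  show "symp word_equiv"
    by (rule sympI) (rule word_equiv_sym)
  show "transp word_equiv"
    by (rule transpI) (rule word_equiv_trans)
qed

lift_definition num_chords :: "chord_diagram \<Rightarrow> nat" is "\<lambda>w. card (set w)"
  by (auto simp: word_equiv_def card_image)

lemma word_equiv_some_word:
  assumes "gauss_word w"
  shows "word_equiv w (some_word (diagram w))"
  using rep_abs_rsp[OF Quotient3_chord_diagram word_equiv_refl[OF assms]] .


section \<open>Simple graphs\<close>

text \<open>A graph is a pair of a vertex set and a set of two-element sets of vertices.\<close>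

type_synonym 'v graph = "'v set \<times> 'v set set"

definition graph_iso :: "'v graph \<Rightarrow> 'w graph \<Rightarrow> bool" where
  "graph_iso G H \<longleftrightarrow> (\<exists>f. bij_betw f (fst G) (fst H) \<and>
     (\<forall>u \<in> fst G. \<forall>v \<in> fst G. {u, v} \<in> snd G \<longleftrightarrow> {f u, f v} \<in> snd H))"

definition closed_walk_edges :: "'v list \<Rightarrow> 'v set set" where
  "closed_walk_edges vs = {{vs ! i, vs ! (Suc i mod length vs)} | i. i < length vs}"

text \<open>
  A cycle is identified with its set of edges, so that neither the starting vertex nor the
  direction of traversal matters.
\<close>

definition cycles :: "'v graph \<Rightarrow> 'v set set set" where
  "cycles G = {closed_walk_edges vs | vs.
     3 \<le> length vs \<and> distinct vs \<and> set vs \<subseteq> fst G \<and> closed_walk_edges vs \<subseteq> snd G}"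

definition at_most_one_cycle :: "'v graph \<Rightarrow> bool" where
  "at_most_one_cycle G \<longleftrightarrow> (\<forall>C \<in> cycles G. \<forall>C' \<in> cycles G. C = C')"


section \<open>Intersection graphs\<close>

definition crossing :: "nat list \<Rightarrow> nat \<Rightarrow> nat \<Rightarrow> bool" where
  "crossing w a b \<longleftrightarrow> a \<noteq> b \<and> filter (\<lambda>c. c \<in> {a, b}) w \<in> {[a, b, a, b], [b, a, b, a]}"

definition word_graph :: "nat list \<Rightarrow> nat graph" where
  "word_graph w = (set w, {{a, b} | a b. crossing w a b})"

text \<open>
  The names of the vertices depend on the choice of a word for the diagram, so the intersection
  graph is only meaningful up to isomorphism; see \<open>intersection_graph_diagram\<close> below.
\<close>

definition intersection_graph :: "chord_diagram \<Rightarrow> nat graph" where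
  "intersection_graph D = word_graph (some_word D)"

lemma crossing_commute: "crossing w a b \<longleftrightarrow> crossing w b a"
  by (auto simp: crossing_def insert_commute)

lemma crossing_in_set: "crossing w a b \<Longrightarrow> a \<in> set w \<and> b \<in> set w"
proof -
  assume "crossing w a b"
  then have "set (filter (\<lambda>c. c \<in> {a, b}) w) = {a, b}"
    by (auto simp: crossing_def simp del: set_filter)
  then show ?thesis by auto
qed

lemma edge_word_graph: "{a, b} \<in> snd (word_graph w) \<longleftrightarrow> crossing w a b"
  by (auto simp: word_graph_def doubleton_eq_iff crossing_commute)

lemma crossing_rotate1_imp: "crossing w a b \<Longrightarrow> crossing (rotate1 w) a b"
  by (cases w) (auto simp: crossing_def split: if_splits)

lemma crossing_rotate_imp: "crossing w a b \<Longrightarrow> crossing (rotate k w) a b"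
  by (induction k) (auto intro: crossing_rotate1_imp)

lemma crossing_map_imp:
  assumes "inj_on f (set w)" "crossing w a b"
  shows "crossing (map f w) (f a) (f b)"
proof -
  have ab: "a \<in> set w" "b \<in> set w"
    using crossing_in_set[OF assms(2)] by simp_all
  have neq: "a \<noteq> b"
    using assms(2) by (simp add: crossing_def)
  have "filter (\<lambda>c. c \<in> {f a, f b}) (map f w) = map f (filter (\<lambda>c. f c \<in> {f a, f b}) w)"
    by (simp add: filter_map comp_def)
  also have "filter (\<lambda>c. f c \<in> {f a, f b}) w = filter (\<lambda>c. c \<in> {a, b}) w"
    using assms(1) ab by (intro filter_cong refl) (simp add: inj_on_eq_iff)
  finally have "filter (\<lambda>c. c \<in> {f a, f b}) (map f w) \<in> {[f a, f b, f a, f b], [f b, f a, f b, f a]}"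
    using assms(2) by (simp only: crossing_def) auto
  moreover have "f a \<noteq> f b"
    using assms(1) ab neq by (simp add: inj_on_eq_iff)
  ultimately show ?thesis
    unfolding crossing_def by (intro conjI)
qed

lemma word_equiv_imp_graph_iso:
  assumes "word_equiv w w'"
  shows "graph_iso (word_graph w) (word_graph w')"
proof -
  obtain f k where f: "inj_on f (set w)" and w': "w' = rotate k (map f w)"
    using assms by (auto simp: word_equiv_def)
  obtain k' where k': "rotate k' (rotate k (map f w)) = map f w"
    using rotate_inverse by blast
  have "bij_betw f (set w) (set w')"
    using f by (simp add: w' bij_betw_def)
  moreover have "crossing w a b \<longleftrightarrow> crossing w' (f a) (f b)" if ab: "a \<in> set w" "b \<in> set w" for a b
  proof
    assume "crossing w a b"
    then show "crossing w' (f a) (f b)"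
      unfolding w' by (intro crossing_rotate_imp crossing_map_imp f)
  next
    assume "crossing w' (f a) (f b)"
    then have "crossing (map f w) (f a) (f b)"
      using crossing_rotate_imp[of w' _ _ k'] k' by (simp add: w')
    then have "crossing (map (inv_into (set w) f) (map f w))
        (inv_into (set w) f (f a)) (inv_into (set w) f (f b))"
      by (rule crossing_map_imp[rotated]) (simp add: inj_on_inv_into)
    moreover have "map (inv_into (set w) f) (map f w) = w"
      using f by (simp add: map_idI)
    ultimately show "crossing w a b"
      using f ab by simp
  qed
  ultimately show ?thesis
    unfolding graph_iso_def edge_word_graph by (auto simp: word_graph_def)
qed

lemma intersection_graph_diagram:
  assumes "gauss_word w"
  shows "graph_iso (word_graph w) (intersection_graph (diagram w))"
  unfolding intersection_graph_def
  by (intro word_equiv_imp_graph_iso word_equiv_some_word assms)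


section \<open>Weight systems\<close>

text \<open>
  The space of chord diagrams of degree \<open>n\<close> is the free module on these diagrams. The sort
  \<open>{comm_ring, comm_monoid_mult}\<close> is that of commutative rings with unity; unlike \<open>comm_ring_1\<close>
  it does not rule out the zero ring.
\<close>

definition diagram_space :: "nat \<Rightarrow> (chord_diagram \<Rightarrow>\<^sub>0 'k::zero) set" where
  "diagram_space n = {v. \<forall>D \<in> Poly_Mapping.keys v. num_chords D = n}"

definition basis_diagram :: "chord_diagram \<Rightarrow> (chord_diagram \<Rightarrow>\<^sub>0 'k::{zero, one})" where
  "basis_diagram D = Poly_Mapping.single D 1"

definition linear_on_diagrams ::
    "nat \<Rightarrow> ((chord_diagram \<Rightarrow>\<^sub>0 'k::{comm_ring, comm_monoid_mult}) \<Rightarrow> 'k) \<Rightarrow> bool" where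
  "linear_on_diagrams n W \<longleftrightarrow>
     (\<forall>v \<in> diagram_space n. \<forall>v' \<in> diagram_space n. W (v + v') = W v + W v') \<and>
     (\<forall>c. \<forall>v \<in> diagram_space n. W (Poly_Mapping.map (\<lambda>x. c * x) v) = c * W v)"

definition one_term :: "nat \<Rightarrow> ((chord_diagram \<Rightarrow>\<^sub>0 'k::{zero, one}) \<Rightarrow> 'k) \<Rightarrow> bool" where
  "one_term n W \<longleftrightarrow>
     (\<forall>w a. gauss_word w \<and> card (set w) = n \<and> a \<in> set w \<and> (\<forall>b. \<not> crossing w a b)
        \<longrightarrow> W (basis_diagram (diagram w)) = 0)"

text \<open>
  In the 4-term relation the circle of the diagram of degree \<open>n - 1\<close> is cut at the point \<open>r\<close>; the
  displayed occurrences of \<open>a\<close> are the endpoints \<open>p\<close> and \<open>q\<close>, and \<open>x\<close> is the added chord, whose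
  endpoint \<open>r\<close> is the first letter. The relation is symmetric in \<open>p\<close> and \<open>q\<close>, so one may
  assume that \<open>p\<close> is met before \<open>q\<close>.
\<close>

definition four_term :: "nat \<Rightarrow> ((chord_diagram \<Rightarrow>\<^sub>0 'k::{comm_ring, one}) \<Rightarrow> 'k) \<Rightarrow> bool" where
  "four_term n W \<longleftrightarrow>
     (\<forall>t u v a x.
        gauss_word (t @ [a] @ u @ [a] @ v) \<and>
        Suc (card (set (t @ [a] @ u @ [a] @ v))) = n \<and>
        x \<notin> set (t @ [a] @ u @ [a] @ v) \<longrightarrow>
          W (basis_diagram (diagram ([x] @ t @ [x, a] @ u @ [a] @ v)))
        - W (basis_diagram (diagram ([x] @ t @ [a, x] @ u @ [a] @ v)))
        + W (basis_diagram (diagram ([x] @ t @ [a] @ u @ [x, a] @ v)))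
        - W (basis_diagram (diagram ([x] @ t @ [a] @ u @ [a, x] @ v))) = 0)"

definition weight_system ::
    "nat \<Rightarrow> ((chord_diagram \<Rightarrow>\<^sub>0 'k::{comm_ring, comm_monoid_mult}) \<Rightarrow> 'k) \<Rightarrow> bool" where
  "weight_system n W \<longleftrightarrow> linear_on_diagrams n W \<and> one_term n W \<and> four_term n W"

end

theory Submission
  imports Defs "HOL-Library.Multiset"
begin

text \<open>
  Only the 4-term relation is used, in the generalized form in which the end of a chord \<open>x\<close> passes
  the two arcs of a share \<open>(P, Q)\<close>, i.e. of a set of chords whose endpoints are exactly those on the
  two arcs.  By induction on trees it shows that a tree-like branch hanging on an end of a chord
  can be slid to the other end, and that two branches hanging on the same end can be interchanged.
  (The step that would require a division by 2 is replaced by the remark that two parallel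
  undecorated chords can exchange their names.)  So leaves can be absorbed one after the other into
  decorations of the chords, until the remaining graph \<open>\<Gamma>\<close> is empty or a cycle.

  A diagram whose graph is a cycle is determined by the graph up to reflection.  By the 4-term
  relation, moving a branch from a chord \<open>b\<close> to a chord \<open>a\<close> crossing it changes the value by a
  difference of values of diagrams whose crossing of \<open>a\<close> and \<open>b\<close> has been removed; these are
  forests, so the change is the same for the diagram and for its reflection.  Once all branches have
  been moved to a single chord, the two diagrams coincide.
\<close>


section \<open>Functions on words satisfying the 4-term relation\<close>

text \<open>The 4-term relation for a share \<open>(P, Q)\<close> links four words; it compares two
  of them only once the other two are known to cancel. For a branch with root \<open>x\<close> there
  are two things to show: it slides along a chord \<open>p\<close>, and it can be interchanged with
  the single chord \<open>p\<close>. By \<open>surround\<close> the defects of these two statements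
  are equal. Hence sliding and interchanging are proved in one induction over
  \<open>branches\<close>; it starts from two single chords, where the second defect vanishes by
  renaming.

  Sliding is also what gives decorated words a meaning: a decoration is attached to the end that
  comes first after the cut, so invariance under rotation requires that a branch may change ends.

  On a cycle, the relabelling of \<open>c j\<close> as \<open>c (- j)\<close> takes the ring word to
  its mirror image, but it permutes the decorated chords. It fixes \<open>c 0\<close>, which is why
  all branches are brought there. A single move may change the value of each word, so the quantity
  that is followed is the difference of the two values.\<close>

definition even_word :: "'a list \<Rightarrow> bool" where
  "even_word w \<longleftrightarrow> (\<forall>a. even (count_list w a))"

lemma count_list_mset: "count_list w a = count (mset w) a"
  by (induction w) auto

lemma gauss_word_mset_cong: "mset u = mset v \<Longrightarrow> gauss_word u = gauss_word v"
  unfolding gauss_word_def count_list_mset by (metis mset_eq_setD)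

lemma gauss_word_imp_even_word: "gauss_word w \<Longrightarrow> even_word w"
  unfolding gauss_word_def even_word_def by (metis count_list_0_iff dvd_0_right dvd_refl)

text \<open>A letter occurs 0 or 2 times in \<open>w\<close>, so a part with an even number of its
  occurrences contains all of them or none. Only multisets are compared: \<open>u\<close> may be
  scattered over \<open>w\<close>.\<close>

lemma gauss_word_appendD:
  assumes "gauss_word w" "mset w = mset (u @ v)" "even_word u"
  shows "set u \<inter> set v = {}" "gauss_word u" "gauss_word v"
proof -
  have c: "count_list u a = 0 \<and> count_list v a = count_list w a \<or>
      count_list u a = 2 \<and> count_list v a = 0 \<and> count_list w a = 2" for a
  proof -
    have "count_list w a = count_list u a + count_list v a"
      using assms(2) by (simp add: count_list_mset)
    moreover have "even (count_list u a)" using assms(3) by (simp add: even_word_def)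
    moreover have "count_list w a = 0 \<or> count_list w a = 2"
      using assms(1) unfolding gauss_word_def by (metis count_list_0_iff)
    ultimately show ?thesis by presburger
  qed
  show "set u \<inter> set v = {}"
    using c by (auto simp: disjoint_iff) (metis count_list_0_iff)
  show "gauss_word u" unfolding gauss_word_def using c by (metis count_list_0_iff)
  show "gauss_word v" unfolding gauss_word_def using c assms(1)
    by (metis count_list_0_iff gauss_word_def zero_neq_numeral)
qed

lemma diff_eq_if_alternating_sums:
  fixes a b c d e z :: "'a::ab_group_add"
  assumes "z - a + c - d = 0" "z - b + c - e = 0"
  shows "a - b = e - d"
proof -
  have "a = z + c - d" "b = z + c - e"
    using assms by (metis add.commute add_diff_eq diff_add_cancel diff_add_eq eq_iff_diff_eq_0)+
  then show ?thesis by simp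
qed

text \<open>Extension by 0 to words that are not Gauss words makes the relations hold for all words,
  since each of them compares rearrangements or renamings of one word. So the calculations carry no
  well-formedness conditions.\<close>

locale four_term_function =
  fixes f :: "nat list \<Rightarrow> 'k::ab_group_add"
  assumes rot: "f (u @ v) = f (v @ u)"
    and rename: "inj_on g (set w) \<Longrightarrow> f (map g w) = f w"
    and four_term: "f ([x] @ t @ [x, a] @ u @ [a] @ v) - f ([x] @ t @ [a, x] @ u @ [a] @ v)
      + f ([x] @ t @ [a] @ u @ [x, a] @ v) - f ([x] @ t @ [a] @ u @ [a, x] @ v) = 0"
    and non_gauss: "\<not> gauss_word w \<Longrightarrow> f w = 0"
begin

lemma eq_if_gauss:
  assumes "mset u = mset v" "gauss_word u \<Longrightarrow> gauss_word v \<Longrightarrow> f u = f v"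
  shows "f u = f v"
  using assms gauss_word_mset_cong[OF assms(1)] non_gauss by metis

text \<open>Here \<open>h i\<close> is the value when the free end of \<open>x\<close> stands before
  position \<open>i\<close> of \<open>z\<close>. In these terms the 4-term relation says that the
  jumps of \<open>h\<close> across the two ends of a chord cancel.\<close>

lemma four_term_positions:
  fixes x :: nat
  assumes "i < j" "j < length z" "z ! i = z ! j"
  defines "h \<equiv> \<lambda>i. f (x # take i z @ x # drop i z)"
  shows "(h i - h (Suc i)) + (h j - h (Suc j)) = 0"
proof -
  define t u v where "t = take i z" and "u = drop (Suc i) (take j z)" and "v = drop (Suc j) z"
  have "take j z = take i z @ z ! i # u"
    using id_take_nth_drop[of i "take j z"] assms(1,2) by (simp add: u_def min_def)
  moreover have z: "z = take j z @ z ! j # v"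
    using assms(2) unfolding v_def by (rule id_take_nth_drop)
  ultimately have tj: "take j z = t @ z ! j # u" and zz: "z = t @ z ! j # u @ z ! j # v"
    using assms(3) by (simp_all add: t_def)
  have li: "length t = i" using assms(1,2) by (simp add: t_def)
  have lj: "j = length t + Suc (length u)"
    using arg_cong[OF tj, of length] assms(2) by simp
  have "take i z = t" "drop i z = z ! j # u @ z ! j # v"
    "take (Suc i) z = t @ [z ! j]" "drop (Suc i) z = u @ z ! j # v"
    "take j z = t @ z ! j # u" "drop j z = z ! j # v"
    "take (Suc j) z = t @ z ! j # u @ [z ! j]" "drop (Suc j) z = v"
    by (subst zz, simp add: li[symmetric] lj)+
  then have "h i = f (x # t @ x # z ! j # u @ z ! j # v)"
    "h (Suc i) = f (x # t @ z ! j # x # u @ z ! j # v)"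
    "h j = f (x # t @ z ! j # u @ x # z ! j # v)"
    "h (Suc j) = f (x # t @ z ! j # u @ z ! j # x # v)"
    unfolding h_def by (simp_all only: append.assoc append_Cons append_Nil)
  then show ?thesis using four_term[of x t "z ! j" u v] by (simp add: algebra_simps)
qed

lemma four_term_sum:
  fixes x :: nat
  assumes "gauss_word z" "finite L"
  defines "h \<equiv> \<lambda>i. f (x # take i z @ x # drop i z)"
  shows "(\<Sum>i\<in>{i. i < length z \<and> z ! i \<in> L}. h i - h (Suc i)) = 0"
proof -
  have "(\<Sum>i\<in>{i. i < length z \<and> z ! i = a}. h i - h (Suc i)) = 0" for a
  proof (cases "a \<in> set z")
    case True
    let ?S = "{i. i < length z \<and> z ! i = a}"
    have "card ?S = count_list z a"
      by (simp add: count_list_eq_length_filter length_filter_conv_card eq_commute[of a])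
    then have "card ?S = 2"
      using True assms(1) by (simp add: gauss_word_def)
    then obtain i j where ij: "?S = {i, j}" "i \<noteq> j" by (auto simp: card_2_iff)
    have "i \<in> ?S" "j \<in> ?S" using ij by blast+
    then have "(h i - h (Suc i)) + (h j - h (Suc j)) = 0"
      using four_term_positions[of i j z x] four_term_positions[of j i z x] ij(2)
      unfolding h_def by (cases "i < j") (auto simp: add.commute)
    then show ?thesis using ij by simp
  next
    case False
    then have "{i. i < length z \<and> z ! i = a} = {}" by auto
    then show ?thesis by (simp only: sum.empty)
  qed
  moreover have "{i \<in> {i. i < length z \<and> z ! i \<in> L}. z ! i = a} = {i. i < length z \<and> z ! i = a}"
    if "a \<in> L" for a using that by auto
  ultimately have "(\<Sum>a\<in>L. \<Sum>i\<in>{i \<in> {i. i < length z \<and> z ! i \<in> L}. z ! i = a}. h i - h (Suc i)) = 0"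
    by simp
  then show ?thesis
    using sum.group[of "{i. i < length z \<and> z ! i \<in> L}" L "(!) z" "\<lambda>i. h i - h (Suc i)"] assms(2)
    by auto
qed

lemma telescope:
  fixes h :: "nat \<Rightarrow> 'k"
  assumes "m \<le> n" shows "(\<Sum>i = m..<n. h i - h (Suc i)) = h m - h n"
proof -
  have "(\<Sum>i = m..<n. h i - h (Suc i)) = - (\<Sum>i = m..<n. h (Suc i) - h i)"
    by (simp add: sum_negf[symmetric])
  then show ?thesis using sum_Suc_diff'[OF assms, of h] by simp
qed

text \<open>The relations of all chords of the share are added. Their ends fill the two intervals
  \<open>P\<close> and \<open>Q\<close>; the jumps of \<open>h\<close> telescope on each, and four
  boundary values remain.\<close>

lemma four_term_share:
  assumes "even_word (P @ Q)"
  shows "f (x # t @ x # P @ u @ Q @ v) - f (x # t @ P @ x # u @ Q @ v)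
    + f (x # t @ P @ u @ x # Q @ v) - f (x # t @ P @ u @ Q @ x # v) = 0"
proof (cases "gauss_word (x # t @ x # P @ u @ Q @ v)")
  case True
  let ?z = "t @ P @ u @ Q @ v"
  have z: "gauss_word ?z"
    using gauss_word_appendD(3)[OF True, of "[x, x]" ?z] by (simp add: even_word_def)
  have dj: "set (P @ Q) \<inter> set (t @ u @ v) = {}"
    using gauss_word_appendD(1)[OF z, of "P @ Q" "t @ u @ v"] assms by simp
  define h where "h i = f (x # take i ?z @ x # drop i ?z)" for i
  define m1 n1 m2 n2 where "m1 = length t" and "n1 = m1 + length P" and "m2 = n1 + length u"
    and "n2 = m2 + length Q"
  note lens = m1_def n1_def m2_def n2_def
  have S: "{i. i < length ?z \<and> ?z ! i \<in> set (P @ Q)} = {m1..<n1} \<union> {m2..<n2}" (is "?L = ?R")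
  proof (rule set_eqI)
    fix i
    have a: "t ! i \<notin> set P" "t ! i \<notin> set Q" if "i < length t" for i
      using that dj nth_mem[OF that] by auto
    have b: "u ! i \<notin> set P" "u ! i \<notin> set Q" if "i < length u" for i
      using that dj nth_mem[OF that] by auto
    have c: "v ! i \<notin> set P" "v ! i \<notin> set Q" if "i < length v" for i
      using that dj nth_mem[OF that] by auto
    consider "i < m1" | "m1 \<le> i" "i < n1" | "n1 \<le> i" "i < m2" | "m2 \<le> i" "i < n2"
      | "n2 \<le> i" "i < length ?z" | "length ?z \<le> i" by linarith
    then show "i \<in> ?L \<longleftrightarrow> i \<in> ?R"
      by cases (auto simp: lens nth_append a b c)
  qed
  have "0 = (\<Sum>i\<in>{m1..<n1} \<union> {m2..<n2}. h i - h (Suc i))"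
    using four_term_sum[OF z, of "set (P @ Q)" x] S unfolding h_def by simp
  also have "\<dots> = (\<Sum>i=m1..<n1. h i - h (Suc i)) + (\<Sum>i=m2..<n2. h i - h (Suc i))"
    by (rule sum.union_disjoint) (auto simp: lens)
  also have "\<dots> = (h m1 - h n1) + (h m2 - h n2)"
    by (subst (1 2) telescope) (auto simp: lens)
  finally show ?thesis
    by (simp add: h_def lens algebra_simps)
next
  case False
  then have "\<not> gauss_word w" if "mset w = mset (x # t @ x # P @ u @ Q @ v)" for w
    using gauss_word_mset_cong[OF that] by simp
  then have "f w = 0" if "mset w = mset (x # t @ x # P @ u @ Q @ v)" for w
    using that non_gauss by blast
  from this[of "x # t @ x # P @ u @ Q @ v"] this[of "x # t @ P @ x # u @ Q @ v"]
    this[of "x # t @ P @ u @ x # Q @ v"] this[of "x # t @ P @ u @ Q @ x # v"]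
  show ?thesis by simp
qed

text \<open>When the second arc of the share is empty, the last two terms of
  \<open>four_term_share\<close> cancel.\<close>

lemma share_past_letter:
  assumes "even_word P"
  shows "f (u @ P @ c # v) = f (u @ c # P @ v)"
proof (rule eq_if_gauss)
  assume g: "gauss_word (u @ P @ c # v)"
  \<comment> \<open>\<open>P\<close> contains an even number of copies of \<open>c\<close>, so the
    second end of \<open>c\<close> lies outside \<open>P\<close>; it serves as the fixed end in the
    4-term relation.\<close>
  have "c \<in> set (u @ v)"
  proof (rule ccontr)
    assume "c \<notin> set (u @ v)"
    then have "count_list (u @ P @ c # v) c = Suc (count_list P c)"
      by (simp add: count_list_0_iff)
    moreover have "count_list (u @ P @ c # v) c = 2" using g by (simp add: gauss_word_def)
    ultimately show False using assms unfolding even_word_def by (metis even_Suc even_numeral)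
  qed
  then obtain t s where ts: "v @ u = t @ c # s"
    by (metis Un_commute set_append split_list)
  have e: "even_word (P @ [])" using assms by simp
  have "f (u @ P @ c # v) = f (P @ c # t @ c # s)"
    using rot[of u "P @ c # v"] ts by simp
  also have "\<dots> = f (c # s @ P @ c # t)"
    using rot[of "P @ c # t" "c # s"] by simp
  also have "\<dots> = f (c # s @ c # P @ t)"
    using four_term_share[OF e, of c s "[]" t] by simp
  also have "\<dots> = f (c # P @ t @ c # s)"
    using rot[of "c # P @ t" "c # s"] by simp
  also have "\<dots> = f (u @ c # P @ v)"
    using rot[of u "c # P @ v"] ts by simp
  finally show "f (u @ P @ c # v) = f (u @ c # P @ v)" .
qed simp

lemma share_move:
  assumes "even_word P"
  shows "f (t @ P @ u @ v) = f (t @ u @ P @ v)"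
proof (induction u arbitrary: t)
  case (Cons c u)
  show ?case
    using Cons.IH[of "t @ [c]"] share_past_letter[OF assms, of t c "u @ v"] by simp
qed simp

text \<open>\<open>slides\<close> lets a decoration change from one end of its chord to the other;
  \<open>nest_commute\<close> interchanges two decorations nested around the same places. The
  quantified context makes both usable inside any word after a rotation.\<close>

definition slides :: "nat list \<Rightarrow> nat list \<Rightarrow> bool" where
  "slides P Q \<longleftrightarrow> (\<forall>p A B. f (P @ p # Q @ A @ p # B) = f (p # A @ P @ p # Q @ B))"

definition nest_commute :: "nat list \<Rightarrow> nat list \<Rightarrow> nat list \<Rightarrow> nat list \<Rightarrow> bool" where
  "nest_commute P Q R S \<longleftrightarrow> (\<forall>A B. f (P @ R @ A @ S @ Q @ B) = f (R @ P @ A @ Q @ S @ B))"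

lemma slidesD: "slides P Q \<Longrightarrow> f (t @ P @ p # Q @ A @ p # B) = f (t @ p # A @ P @ p # Q @ B)"
  using rot[of t "P @ p # Q @ A @ p # B"] rot[of t "p # A @ P @ p # Q @ B"]
  by (simp add: slides_def)

lemma nest_commuteD: "nest_commute P Q R S \<Longrightarrow> f (t @ P @ R @ A @ S @ Q @ B) = f (t @ R @ P @ A @ Q @ S @ B)"
  using rot[of t "P @ R @ A @ S @ Q @ B"] rot[of t "R @ P @ A @ Q @ S @ B"]
  by (simp add: nest_commute_def)

text \<open>
  Compare the generalized 4-term relations in which the decorated end of \<open>x\<close> is fixed just
  before \<open>P\<close> and just before \<open>Q\<close>.
\<close>

lemma surround:
  assumes "slides M N" "even_word (P @ Q)" "even_word (M @ N)"
  shows "f (M @ x # N @ P @ x # A @ Q @ B) - f (P @ A @ M @ x # N @ Q @ x # B)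
    = f (P @ M @ x # N @ A @ x # Q @ B) - f (M @ x # N @ P @ A @ Q @ x # B)"
proof -
  have e: "even_word (Q @ P)" "even_word (M @ x # N @ [x])"
    using assms(2,3) by (auto simp: even_word_def add.commute)
  define Z where "Z = f (M @ x # N @ x # P @ A @ Q @ B)"
  define c where "c = f (M @ x # N @ P @ A @ x # Q @ B)"
  have c': "c = f (x # P @ A @ M @ x # N @ Q @ B)"
    unfolding c_def using slidesD[OF assms(1), of "[]" x "P @ A" "Q @ B"] by simp
  have "f (P @ M @ x # N @ A @ x # Q @ B) = f (P @ x # A @ M @ x # N @ Q @ B)"
    by (rule slidesD[OF assms(1)])
  moreover have "Z = f (P @ A @ M @ x # N @ x # Q @ B)"
    unfolding Z_def using share_move[OF e(2), of "[]" "P @ A" "Q @ B"] by simp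
  moreover have "Z - f (M @ x # N @ P @ x # A @ Q @ B) + c - f (M @ x # N @ P @ A @ Q @ x # B) = 0"
    using four_term_share[OF assms(2), of x N A "B @ M"]
      rot[of M "x # N @ x # P @ A @ Q @ B"] rot[of M "x # N @ P @ x # A @ Q @ B"]
      rot[of M "x # N @ P @ A @ x # Q @ B"] rot[of M "x # N @ P @ A @ Q @ x # B"]
    by (simp add: Z_def c_def)
  moreover have "f (P @ A @ M @ x # N @ x # Q @ B) - f (P @ A @ M @ x # N @ Q @ x # B) + c
      - f (P @ x # A @ M @ x # N @ Q @ B) = 0"
    using four_term_share[OF e(1), of x N B "A @ M"]
      rot[of "P @ A @ M" "x # N @ x # Q @ B"] rot[of "P @ A @ M" "x # N @ Q @ x # B"]
      rot[of "x # P @ A @ M" "x # N @ Q @ B"] rot[of "P @ x # A @ M" "x # N @ Q @ B"]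
    by (simp add: c')
  ultimately show ?thesis
    by (metis diff_eq_if_alternating_sums)
qed

text \<open>In a Gauss word the two names occur nowhere else, so their transposition leaves
  \<open>A\<close> and \<open>B\<close> alone.\<close>

lemma swap_names:
  "f (p # x # A @ x # p # B) = f (x # p # A @ p # x # B)"
proof (rule eq_if_gauss)
  assume g: "gauss_word (p # x # A @ x # p # B)"
  show "f (p # x # A @ x # p # B) = f (x # p # A @ p # x # B)"
  proof (cases "p = x")
    case False
    have "count_list (p # x # A @ x # p # B) a = 2" if "a \<in> {p, x}" for a
      using g that by (auto simp: gauss_word_def)
    from this[of p] this[of x] have "p \<notin> set (A @ B)" "x \<notin> set (A @ B)"
      using False by (auto simp: count_list_0_iff)
    moreover define g where "g c = (if c = p then x else if c = x then p else c)" for c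
    ultimately have "map g (p # x # A @ x # p # B) = x # p # A @ p # x # B"
      by (auto intro!: map_idI)
    moreover have "inj g" by (auto simp: inj_def g_def)
    ultimately show ?thesis using rename[of g "p # x # A @ x # p # B"]
      by (metis inj_on_subset subset_UNIV)
  qed simp
qed simp

lemma slides_Nil: "slides [] []" by (simp add: slides_def)

text \<open>In \<open>surround\<close> with \<open>M = N = []\<close> the left side is the sliding
  defect of \<open>x\<close> along \<open>p\<close>; the right side compares the two orders of two
  parallel chords and is 0 by \<open>swap_names\<close>.\<close>

lemma slides_singleton: "slides [x] [x]"
  unfolding slides_def
proof (intro allI)
  fix p :: nat and A B
  have "even_word [p, p]" "even_word []" by (simp_all add: even_word_def)
  then show "f ([x] @ p # [x] @ A @ p # B) = f (p # A @ [x] @ p # [x] @ B)"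
    using surround[OF slides_Nil, of "[p]" "[p]" x A B] swap_names[of p x A B] by simp
qed

end

text \<open>
  The words before and after an end of a chord, for the tree-like branches hanging on it.  In the
  rule \<open>root\<close>, the chord \<open>x\<close> crosses the given chord and carries the branches \<open>(P, Q)\<close> on its first end.
\<close>

inductive branches :: "nat list \<Rightarrow> nat list \<Rightarrow> bool" where
  Nil: "branches [] []"
| nest: "branches P Q \<Longrightarrow> branches R S \<Longrightarrow> branches (P @ R) (S @ Q)"
| root: "branches P Q \<Longrightarrow> branches (P @ x # Q) [x]"

lemma even_word_branches: "branches P Q \<Longrightarrow> even_word (P @ Q)"
  by (induction rule: branches.induct) (auto simp: even_word_def)

context four_term_function
begin

text \<open>In the case \<open>root\<close>, \<open>surround\<close> for the share
  \<open>(P @ y # Q, [y])\<close> has the interchange defect on its right. The two words on its left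
  agree: the branch of \<open>x\<close> is slid along \<open>y\<close> and then passes
  \<open>(P, Q)\<close> by the induction hypothesis. The lemma is applied first to a single chord
  and then to a general root.\<close>

lemma nest_commute_root_branches:
  assumes MN: "slides M N" "even_word (M @ N)" "slides (M @ x # N) [x]"
    and "branches P Q"
  shows "nest_commute (M @ x # N) [x] P Q"
  using assms(4)
proof (induction rule: branches.induct)
  case Nil
  then show ?case by (simp add: nest_commute_def)
next
  case (nest P Q R S)
  show ?case unfolding nest_commute_def
  proof (intro allI)
    fix A B
    show "f ((M @ x # N) @ (P @ R) @ A @ (S @ Q) @ [x] @ B) =
        f ((P @ R) @ (M @ x # N) @ A @ [x] @ (S @ Q) @ B)"
      using nest_commuteD[OF nest.IH(1), of "[]" "R @ A @ S" B]
        nest_commuteD[OF nest.IH(2), of P "A" "Q @ B"] by simp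
  qed
next
  case (root P Q y)
  show ?case unfolding nest_commute_def
  proof (intro allI)
    fix A B
    have e: "even_word ((P @ y # Q) @ [y])"
      using even_word_branches[OF root.hyps] by (auto simp: even_word_def)
    have "f ((P @ y # Q) @ A @ M @ x # N @ [y] @ x # B)
        = f ((Q @ A) @ (M @ x # N) @ y # [x] @ B @ P @ [y])"
      using rot[of "P @ [y]" "Q @ A @ M @ x # N @ y # x # B"] by simp
    also have "\<dots> = f (y # (Q @ A) @ (M @ x # N) @ y # [x] @ B @ P)"
      using rot[of "(Q @ A) @ (M @ x # N) @ y # [x] @ B @ P" "[y]"] by simp
    also have "\<dots> = f ((M @ x # N) @ y # [x] @ Q @ A @ y # B @ P)"
      using slidesD[OF MN(3), of "[]" y "Q @ A" "B @ P"] by simp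
    also have "\<dots> = f (P @ (M @ x # N) @ [y] @ [x] @ Q @ A @ y # B)"
      using rot[of "(M @ x # N) @ y # [x] @ Q @ A @ y # B" P] by simp
    also have "\<dots> = f ((M @ x # N) @ P @ y # Q @ x # A @ y # B)"
      using nest_commuteD[OF root.IH, of "[]" "[y]" "A @ y # B"] by simp
    finally have "f (M @ x # N @ (P @ y # Q) @ x # A @ [y] @ B)
        - f ((P @ y # Q) @ A @ M @ x # N @ [y] @ x # B) = 0" by simp
    then show "f ((M @ x # N) @ (P @ y # Q) @ A @ [y] @ [x] @ B) =
        f ((P @ y # Q) @ (M @ x # N) @ A @ [x] @ [y] @ B)"
      using surround[OF MN(1) e MN(2), of x A B] by simp
  qed
qed

lemma slides_and_nest_commute:
  "branches P Q \<Longrightarrow> slides P Q \<and> (\<forall>R S. branches R S \<longrightarrow> nest_commute P Q R S)"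
proof (induction rule: branches.induct)
  case Nil
  then show ?case by (simp add: slides_Nil nest_commute_def)
next
  case (nest P Q R S)
  have "slides (P @ R) (S @ Q)" unfolding slides_def
  proof (intro allI)
    fix p A B
    have "f (P @ R @ p # S @ Q @ A @ p # B) = f (P @ p # Q @ A @ R @ p # S @ B)"
      using slidesD[of R S P p "Q @ A" "B"] nest.IH by simp
    also have "\<dots> = f (p # A @ R @ P @ p # Q @ S @ B)"
      using slidesD[of P Q "[]" p "A @ R" "S @ B"] nest.IH by simp
    \<comment> \<open>Sliding the inner branch first and the outer one second has reversed their
      nesting.\<close>
    also have "\<dots> = f (p # A @ P @ R @ p # S @ Q @ B)"
      using nest_commuteD[of P Q R S "p # A" "[p]" B] nest by simp
    finally show "f ((P @ R) @ p # (S @ Q) @ A @ p # B) = f (p # A @ (P @ R) @ p # (S @ Q) @ B)"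
      by simp
  qed
  moreover have "nest_commute (P @ R) (S @ Q) R' S'" if "branches R' S'" for R' S'
    unfolding nest_commute_def
  proof (intro allI)
    fix A B
    show "f ((P @ R) @ R' @ A @ S' @ (S @ Q) @ B) = f (R' @ (P @ R) @ A @ (S @ Q) @ S' @ B)"
      using nest_commuteD[of P Q R' S' "[]" "R @ A @ S" B]
        nest_commuteD[of R S R' S' P A "Q @ B"] nest.IH that by simp
  qed
  ultimately show ?case by blast
next
  case (root M N x)
  have MN: "slides M N" "even_word (M @ N)"
    using root even_word_branches by blast+
  have "even_word []" by (simp add: even_word_def)
  \<comment> \<open>The single chord comes first: it makes the right side of \<open>surround\<close>
    vanish for \<open>P = Q = [p]\<close>, and the left side is then the sliding of the new
    root.\<close>
  then have "nest_commute [y] [y] (M @ x # N) [x]" for y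
    using nest_commute_root_branches[OF slides_Nil, of y "M @ x # N" "[x]"]
      slides_singleton[of y] branches.root[OF root.hyps] by simp
  then have "f (p # (M @ x # N) @ A @ [x] @ p # B) = f ((M @ x # N) @ p # A @ p # [x] @ B)" for p A B
    using nest_commuteD[of "[p]" "[p]" "M @ x # N" "[x]" "[]" A B] by simp
  moreover have "even_word [p, p]" for p :: nat by (simp add: even_word_def)
  ultimately have sl: "slides (M @ x # N) [x]"
    unfolding slides_def using surround[OF MN(1) _ MN(2), of "[p]" "[p]" x for p] by simp
  show ?case using sl nest_commute_root_branches[OF MN sl] by blast
qed

lemmas slides_branches = slides_and_nest_commute[THEN conjunct1]
lemmas nest_commute_branches = slides_and_nest_commute[THEN conjunct2, rule_format]

end

section \<open>Words with decorated chords\<close>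

text \<open>
  The decoration of a chord is written around the first occurrence of its letter; \<open>S\<close> collects the
  letters that have already been met.
\<close>

fun decorate :: "(nat \<Rightarrow> nat list \<times> nat list) \<Rightarrow> nat set \<Rightarrow> nat list \<Rightarrow> nat list" where
  "decorate d S [] = []"
| "decorate d S (a # w) =
    (if a \<in> S then a # decorate d S w
     else fst (d a) @ a # snd (d a) @ decorate d (insert a S) w)"

lemma decorate_append: "decorate d S (u @ v) = decorate d S u @ decorate d (S \<union> set u) v"
proof (induction u arbitrary: S)
  case (Cons a u)
  have "insert a S \<union> set u = S \<union> set (a # u)" by simp
  then show ?case using Cons by (simp add: insert_absorb)
qed simp

lemma decorate_cong:
  assumes "\<And>a. a \<in> set w \<Longrightarrow> a \<in> S \<longleftrightarrow> a \<in> S'" "\<And>a. a \<in> set w \<Longrightarrow> a \<notin> S \<Longrightarrow> d a = d' a"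
  shows "decorate d S w = decorate d' S' w"
  using assms
proof (induction w arbitrary: S S')
  case (Cons a w)
  then show ?case by (auto intro!: Cons.IH)
qed simp

lemma decorate_trivial: "(\<And>a. a \<in> set w \<Longrightarrow> a \<notin> S \<Longrightarrow> d a = ([], [])) \<Longrightarrow> decorate d S w = w"
proof (induction w arbitrary: S)
  case (Cons a w)
  then show ?case using Cons.IH[of "insert a S"] Cons.IH[of S] by auto
qed simp

definition branch_decoration :: "(nat \<Rightarrow> nat list \<times> nat list) \<Rightarrow> bool" where
  "branch_decoration d \<longleftrightarrow> (\<forall>a. branches (fst (d a)) (snd (d a)))"

lemma branch_decorationD: "branch_decoration d \<Longrightarrow> branches (fst (d a)) (snd (d a))"
  by (simp add: branch_decoration_def)

lemma branch_decoration_upd: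
  "branch_decoration d \<Longrightarrow> branches P Q \<Longrightarrow> branch_decoration (d(a := (P, Q)))"
  by (simp add: branch_decoration_def)

lemma even_count_decorate:
  assumes "branch_decoration d"
  shows "even (count_list (decorate d S w) c) \<longleftrightarrow> even (count_list w c)"
proof (induction w arbitrary: S)
  case (Cons a w)
  have "even (count_list (fst (d a)) c + count_list (snd (d a)) c)"
    using even_word_branches[OF branch_decorationD[OF assms]] by (simp add: even_word_def)
  then show ?case using Cons by auto
qed simp

lemma even_word_decorate: "branch_decoration d \<Longrightarrow> even_word w \<Longrightarrow> even_word (decorate d S w)"
  by (simp add: even_word_def even_count_decorate)

lemma gauss_word_Cons_split:
  assumes "gauss_word (a # w)"
  obtains u v where "w = u @ a # v" "a \<notin> set u" "a \<notin> set v"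
proof -
  have c: "count_list w a = 1" using assms by (simp add: gauss_word_def)
  then have "a \<in> set w" by (metis count_list_0_iff zero_neq_one)
  then obtain u v where "w = u @ a # v" "a \<notin> set u" by (metis split_list_first)
  then show ?thesis using that c by (auto simp: count_list_0_iff)
qed

lemma gauss_word_two:
  assumes "gauss_word (u @ a # v @ a # w)" shows "a \<notin> set u" "a \<notin> set v" "a \<notin> set w"
proof -
  have "count_list (u @ a # v @ a # w) a = 2" using assms by (simp add: gauss_word_def)
  then show "a \<notin> set u" "a \<notin> set v" "a \<notin> set w" by (auto simp: count_list_0_iff)
qed

lemma gauss_word_rot: "gauss_word (u @ v) \<Longrightarrow> gauss_word (v @ u)"
  using gauss_word_mset_cong[of "u @ v" "v @ u"] by simp

text \<open>The two ends of \<open>x\<close> enclose the old decoration of \<open>a\<close>, as they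
  do in a word \<open>x a x\<close>: the leaf becomes the outermost branch.\<close>

definition graft :: "(nat \<Rightarrow> nat list \<times> nat list) \<Rightarrow> nat \<Rightarrow> nat \<Rightarrow> nat \<Rightarrow> nat list \<times> nat list" where
  "graft d x a = d(a := (fst (d x) @ x # snd (d x) @ fst (d a), snd (d a) @ [x]))"

lemma branch_decoration_graft: "branch_decoration d \<Longrightarrow> branch_decoration (graft d x a)"
  using branches.nest[OF branches.root[OF branch_decorationD[of d x]] branch_decorationD[of d a], of x]
  unfolding graft_def by (auto intro: branch_decoration_upd)

context four_term_function
begin

text \<open>The word \<open>z\<close> collects parts that have been split off. An even word can
  stand anywhere on the circle, so it is kept at the end, with its branches already written
  out.\<close>

definition val :: "(nat \<Rightarrow> nat list \<times> nat list) \<Rightarrow> nat list \<Rightarrow> nat list \<Rightarrow> 'k" where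
  "val d z w = f (decorate d {} w @ z)"

text \<open>Rotation changes which end of \<open>a\<close> comes first, so the decoration slides to
  the other end; the bare end then passes the even word \<open>z\<close>.\<close>

lemma val_rotate1:
  assumes "branch_decoration d" "even_word z" "gauss_word (a # w)"
  shows "val d z (a # w) = val d z (w @ [a])"
proof -
  obtain u v where w: "w = u @ a # v" "a \<notin> set u" "a \<notin> set v"
    using gauss_word_Cons_split[OF assms(3)] .
  let ?P = "fst (d a)" and ?Q = "snd (d a)"
  have s: "slides ?P ?Q" using slides_branches branch_decorationD[OF assms(1)] .
  have u: "decorate d {a} u = decorate d {} u" by (rule decorate_cong) (use w in auto)
  define U V where "U = decorate d {} u" and "V = decorate d (insert a (set u)) v"
  have "val d z (a # w) = f (?P @ a # ?Q @ U @ a # V @ z)"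
    by (simp add: val_def w decorate_append u U_def V_def)
  also have "\<dots> = f (a # U @ ?P @ a # ?Q @ V @ z)"
    using slidesD[OF s, of "[]"] by simp
  also have "\<dots> = f (U @ ?P @ a # ?Q @ V @ z @ [a])"
    using rot[of "[a]" "U @ ?P @ a # ?Q @ V @ z"] by simp
  also have "\<dots> = f (U @ ?P @ a # ?Q @ V @ a # z)"
    using share_move[OF assms(2), of "U @ ?P @ a # ?Q @ V" "[a]" "[]"] by simp
  also have "\<dots> = val d z (w @ [a])"
    using w(2) by (simp add: val_def w decorate_append U_def V_def)
  finally show ?thesis .
qed

lemma val_rot:
  assumes "branch_decoration d" "even_word z" "gauss_word (u @ v)"
  shows "val d z (u @ v) = val d z (v @ u)"
  using assms(3)
proof (induction u arbitrary: v)
  case (Cons a u)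
  have "gauss_word ((u @ v) @ [a])" using gauss_word_rot[of "[a]" "u @ v"] Cons.prems by simp
  then show ?case using Cons.IH[of "v @ [a]"] val_rotate1[OF assms(1,2), of a "u @ v"] Cons.prems
    by simp
qed simp

text \<open>Since \<open>x\<close> separates \<open>U\<close> from \<open>V\<close>,
  \<open>U\<close> with its decorations is an even word. Moving it away makes the ends of
  \<open>x\<close> adjacent, and \<open>x\<close> with its branches becomes an even word that can
  join \<open>z\<close>.\<close>

lemma val_isolated:
  assumes "branch_decoration d" "even_word z" "gauss_word (x # U @ x # V)" "set U \<inter> set V = {}"
  shows "val d z (x # U @ x # V) = val d (fst (d x) @ x # snd (d x) @ [x] @ z) (U @ V)"
    "even_word (fst (d x) @ x # snd (d x) @ [x] @ z)"
proof -
  have x: "x \<notin> set U" "x \<notin> set V" using gauss_word_two[of "[]"] assms(3) by auto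
  have "even (count_list U c)" for c
  proof (cases "c \<in> set U")
    case True
    then have "c \<notin> set V" "c \<noteq> x" using x assms(4) by auto
    moreover have "count_list (x # U @ x # V) c = 2"
      using assms(3) True by (simp add: gauss_word_def)
    ultimately show ?thesis by (simp add: count_list_0_iff)
  qed (simp add: count_list_0_iff)
  then have eU: "even_word (decorate d {} U)"
    using even_word_decorate[OF assms(1)] by (simp add: even_word_def)
  let ?P = "fst (d x)" and ?Q = "snd (d x)"
  have eX: "even_word (?P @ x # ?Q @ [x])"
    using even_word_branches[OF branches.root[OF branch_decorationD[OF assms(1)]]] by simp
  then show "even_word (?P @ x # ?Q @ [x] @ z)"
    using assms(2) by (simp add: even_word_def)
  have "decorate d {x} U = decorate d {} U" "decorate d (insert x (set U)) V = decorate d (set U) V"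
    by (rule decorate_cong; use x in auto)+
  then have "val d z (x # U @ x # V)
      = f ((?P @ x # ?Q) @ [x] @ decorate d {} U @ decorate d (set U) V @ z)"
    using share_move[OF eU, of "?P @ x # ?Q" "[x]"] by (simp add: val_def decorate_append)
  also have "\<dots> = f (decorate d {} U @ decorate d (set U) V @ ?P @ x # ?Q @ x # z)"
    using share_move[OF eX, of "[]" "decorate d {} U @ decorate d (set U) V" z] by simp
  finally show "val d z (x # U @ x # V) = val d (?P @ x # ?Q @ [x] @ z) (U @ V)"
    by (simp add: val_def decorate_append)
qed

lemma val_leaf_adjacent:
  assumes "gauss_word (x # a # x # V)" "x \<noteq> a"
  shows "val d z (x # a # x # V) = val (graft d x a) z (a # V)"
proof -
  have "x \<notin> set V" using gauss_word_two[of "[]" x "[a]" V] assms by simp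
  then have "decorate d {a, x} V = decorate (graft d x a) {a} V"
    by (intro decorate_cong) (auto simp: graft_def)
  then show ?thesis using assms(2) by (simp add: val_def graft_def)
qed

lemma val_swap_decorations:
  assumes "branches P Q" "branches R S"
  shows "val (d(a := (P @ R @ A, B @ S @ Q))) z w = val (d(a := (R @ P @ A, B @ Q @ S))) z w"
proof (cases "a \<in> set w")
  case True
  then obtain u v where w: "w = u @ a # v" "a \<notin> set u" by (metis split_list_first)
  have "decorate (d(a := X)) {} u = decorate d {} u" for X
    by (rule decorate_cong) (use w in auto)
  moreover have "decorate (d(a := X)) (insert a (set u)) v = decorate d (insert a (set u)) v" for X
    by (rule decorate_cong) auto
  ultimately show ?thesis
    using w(2) nest_commuteD[OF nest_commute_branches[OF assms], of "decorate d {} u" "A @ a # B"]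
    by (simp add: val_def w decorate_append)
next
  case False
  then have "decorate (d(a := X)) {} w = decorate d {} w" for X
    by (intro decorate_cong) auto
  then show ?thesis by (simp add: val_def)
qed

lemma four_term_share':
  assumes "even_word (P @ Q)" "a \<in> set S"
  shows "f (a # P @ u @ Q @ S) - f (P @ a # u @ Q @ S) + f (P @ u @ a # Q @ S) - f (P @ u @ Q @ a # S) = 0"
proof -
  obtain s t where S: "S = s @ a # t" using assms(2) by (metis split_list)
  show ?thesis
    using four_term_share[OF assms(1), of a t u s] rot[of "a # P @ u @ Q @ s" "a # t"]
      rot[of "P @ a # u @ Q @ s" "a # t"] rot[of "P @ u @ a # Q @ s" "a # t"]
      rot[of "P @ u @ Q @ a # s" "a # t"]
    by (simp add: S)
qed

text \<open>
  In the language of Lie algebras: a branch can be moved from one argument of the bracket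
  \<open>[a, b]\<close> to the other.
\<close>

lemma through_vertex:
  assumes "even_word (X @ Y)" "a \<in> set S" "b \<in> set S"
  shows "f (a # X @ b # Y @ S) - f (X @ b # Y @ a # S)
    = f (X @ a # Y @ b # S) - f (b # X @ a # Y @ S)"
proof -
  \<comment> \<open>One relation moves the end \<open>a\<close>, the other the end \<open>b\<close>.
    They share the two words with both ends between \<open>X\<close> and \<open>Y\<close>, which are
    eliminated.\<close>
  have "p - s = v - t" if "p - q + r - s = 0" "t - r + q - v = 0" for p q r s t v :: 'k
  proof -
    have "(p - s) - (q - r) = p - q + r - s" "(q - r) - (v - t) = t - r + q - v"
      by (simp_all add: algebra_simps)
    then show ?thesis using that by simp
  qed
  from this[of "f (a # X @ b # Y @ S)" "f (X @ a # b # Y @ S)" "f (X @ b # a # Y @ S)"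
      "f (X @ b # Y @ a # S)" "f (b # X @ a # Y @ S)" "f (X @ a # Y @ b # S)"]
  show ?thesis
    using four_term_share'[OF assms(1,2), of "[b]"] four_term_share'[OF assms(1,3), of "[a]"] by simp
qed

text \<open>The decoration of \<open>a\<close> is first slid to the other end of \<open>a\<close>,
  so that only that of \<open>b\<close> is near the crossing and \<open>through_vertex\<close>
  applies. When it is slid back, the part coming from \<open>b\<close> is outermost.\<close>

lemma val_through_vertex:
  assumes "branch_decoration d" "gauss_word (a # b # S)" "a \<noteq> b"
  defines "d' \<equiv> d(b := ([], []), a := (fst (d b) @ fst (d a), snd (d a) @ snd (d b)))"
  shows "val d z (a # b # S) - val d z (b # a # S) = val d' z (a # b # S) - val d' z (b # a # S)"
proof -
  let ?P = "fst (d a)" and ?Q = "snd (d a)" and ?X = "fst (d b)" and ?Y = "snd (d b)"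
  have s: "slides ?P ?Q" using slides_branches branch_decorationD[OF assms(1)] .
  obtain u v where bS: "b # S = u @ a # v" "a \<notin> set u" "a \<notin> set v"
    using gauss_word_Cons_split[OF assms(2)] .
  then obtain s t where S: "S = s @ a # t" "a \<notin> set s" "a \<notin> set t"
    using assms(3) by (cases u) auto
  have "count_list (a # b # S) b = 2" using assms(2) by (simp add: gauss_word_def)
  then have "count_list S b \<noteq> 0" using assms(3) by simp
  then have b: "b \<in> set S" by (simp add: count_list_0_iff)
  define s' t' where "s' = decorate d {a, b} s" and "t' = decorate d ({a, b} \<union> set s) t"
  have dS: "decorate d {a, b} S = s' @ a # t'" by (simp add: S decorate_append s'_def t'_def)
  have d'S: "decorate d' {a, b} S = decorate d {a, b} S"
    by (rule decorate_cong) (auto simp: d'_def)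
  have bS': "b \<in> set (s' @ ?P @ a # ?Q @ t' @ z)"
  proof -
    have "b \<in> set (decorate d T w)" if "b \<in> set w" for T w
      using that by (induction w arbitrary: T) auto
    then show ?thesis using b S(1) assms(3) by (auto simp: s'_def t'_def)
  qed
  have sl: "f (T @ ?P @ a # ?Q @ U @ s' @ a # t' @ z) = f (T @ a # U @ s' @ ?P @ a # ?Q @ t' @ z)" for T U
    using slidesD[OF s, of T a "U @ s'" "t' @ z"] by simp
  have "val d z (a # b # S) = f (a # ?X @ b # ?Y @ s' @ ?P @ a # ?Q @ t' @ z)"
    using sl[of "[]" "?X @ b # ?Y"] assms(3) by (simp add: val_def dS insert_commute)
  moreover have "val d z (b # a # S) = f (?X @ b # ?Y @ a # s' @ ?P @ a # ?Q @ t' @ z)"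
    using sl[of "?X @ b # ?Y" "[]"] assms(3) by (simp add: val_def dS)
  moreover have "val d' z (a # b # S) = f (?X @ a # ?Y @ b # s' @ ?P @ a # ?Q @ t' @ z)"
    using sl[of "?X" "?Y @ [b]"] assms(3) d'S
    by (simp add: val_def dS insert_commute) (simp add: d'_def)
  moreover have "val d' z (b # a # S) = f (b # ?X @ a # ?Y @ s' @ ?P @ a # ?Q @ t' @ z)"
    using sl[of "b # ?X" "?Y"] assms(3) d'S
    by (simp add: val_def dS) (simp add: d'_def)
  moreover have "even_word (?X @ ?Y)" by (rule even_word_branches[OF branch_decorationD[OF assms(1)]])
  ultimately show ?thesis
    using through_vertex[of ?X ?Y a "s' @ ?P @ a # ?Q @ t' @ z" b] bS' by simp
qed

end

section \<open>Graphs with at most one cycle\<close>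

definition cycle_list :: "('v \<Rightarrow> 'v \<Rightarrow> bool) \<Rightarrow> 'v list \<Rightarrow> bool" where
  "cycle_list E vs \<longleftrightarrow> 3 \<le> length vs \<and> distinct vs \<and> successively E vs \<and> E (last vs) (hd vs)"

definition acyclic_on :: "('v \<Rightarrow> 'v \<Rightarrow> bool) \<Rightarrow> 'v set \<Rightarrow> bool" where
  "acyclic_on E S \<longleftrightarrow> (\<forall>vs. cycle_list E vs \<longrightarrow> \<not> set vs \<subseteq> S)"

definition unicyclic_on :: "('v \<Rightarrow> 'v \<Rightarrow> bool) \<Rightarrow> 'v set \<Rightarrow> bool" where
  "unicyclic_on E S \<longleftrightarrow> (\<forall>vs vs'. cycle_list E vs \<and> set vs \<subseteq> S \<and> cycle_list E vs' \<and> set vs' \<subseteq> S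
     \<longrightarrow> closed_walk_edges vs = closed_walk_edges vs')"

lemma cycle_list_nth:
  assumes "cycle_list E vs" "i < length vs"
  shows "E (vs ! i) (vs ! (Suc i mod length vs))"
proof (cases "Suc i < length vs")
  case True
  then show ?thesis using assms by (simp add: cycle_list_def successively_conv_nth)
next
  case False
  then have i: "Suc i = length vs" "vs \<noteq> []" using assms by auto
  then have "i = length vs - 1" by simp
  then show ?thesis using assms i by (simp add: cycle_list_def last_conv_nth hd_conv_nth)
qed

lemma cycle_list_rotate: "cycle_list E vs \<Longrightarrow> cycle_list E (rotate k vs)"
proof (induction k)
  case (Suc k)
  then show ?case
    by (cases "rotate k vs") (auto simp: cycle_list_def successively_append_iff successively_Cons hd_append
        split: if_splits)
qed simp

lemma Union_closed_walk_edges: "\<Union> (closed_walk_edges vs) = set vs"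
proof
  show "\<Union> (closed_walk_edges vs) \<subseteq> set vs"
    by (auto simp: closed_walk_edges_def intro!: nth_mem mod_less_divisor)
  show "set vs \<subseteq> \<Union> (closed_walk_edges vs)"
  proof
    fix v assume "v \<in> set vs"
    then obtain i where "i < length vs" "v = vs ! i" by (metis in_set_conv_nth)
    then have "{v, vs ! (Suc i mod length vs)} \<in> closed_walk_edges vs"
      by (auto simp: closed_walk_edges_def)
    then show "v \<in> \<Union> (closed_walk_edges vs)" by blast
  qed
qed

lemma closed_walk_edges_hd: "{u, v} \<in> closed_walk_edges (u # v # vs)"
  unfolding closed_walk_edges_def by (rule CollectI, rule exI[of _ 0]) simp

lemma closed_walk_edges_last: "{last (u # vs), u} \<in> closed_walk_edges (u # vs)"
  unfolding closed_walk_edges_def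
  by (rule CollectI, rule exI[of _ "length vs"]) (simp add: last_conv_nth)

lemma cycle_list_edge:
  assumes "cycle_list E vs" "symp E" "{u, v} \<in> closed_walk_edges vs"
  shows "E u v"
proof -
  obtain i where "i < length vs" "{u, v} = {vs ! i, vs ! (Suc i mod length vs)}"
    using assms(3) by (auto simp: closed_walk_edges_def)
  then show ?thesis
    using cycle_list_nth[OF assms(1)] sympD[OF assms(2)] by (auto simp: doubleton_eq_iff)
qed

lemma unicyclic_on_vertices:
  assumes "unicyclic_on E S" "cycle_list E vs" "set vs \<subseteq> S" "cycle_list E vs'" "set vs' \<subseteq> S"
  shows "closed_walk_edges vs = closed_walk_edges vs'" "set vs = set vs'"
  using assms Union_closed_walk_edges unfolding unicyclic_on_def by metis+

section \<open>Longest paths, leaves and cycles\<close>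

definition longest_path :: "('v \<Rightarrow> 'v \<Rightarrow> bool) \<Rightarrow> 'v set \<Rightarrow> 'v list \<Rightarrow> bool" where
  "longest_path E S p \<longleftrightarrow> distinct p \<and> set p \<subseteq> S \<and> successively E p \<and>
     (\<forall>q. distinct q \<and> set q \<subseteq> S \<and> successively E q \<longrightarrow> length q \<le> length p)"

lemma longest_pathD:
  assumes "longest_path E S p"
  shows "distinct p" "set p \<subseteq> S" "successively E p"
    "distinct q \<Longrightarrow> set q \<subseteq> S \<Longrightarrow> successively E q \<Longrightarrow> length q \<le> length p"
  using assms unfolding longest_path_def by blast+

lemma longest_path_exists:
  assumes "finite S"
  shows "\<exists>p. longest_path E S p"
proof -
  let ?P = "\<lambda>p. distinct p \<and> set p \<subseteq> S \<and> successively E p"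
  have "length p \<le> card S" if "?P p" for p
    using that assms by (metis card_mono distinct_card)
  then show ?thesis
    using ex_has_greatest_nat[of ?P "[]" length "Suc (card S)"]
    unfolding longest_path_def by (auto simp: less_Suc_eq_le)
qed

lemma longest_path_rev: "symp E \<Longrightarrow> longest_path E S p \<Longrightarrow> longest_path E S (rev p)"
proof -
  assume "symp E"
  then have "(\<lambda>x y. E y x) = E" by (auto simp: fun_eq_iff dest: sympD)
  then have "successively E (rev p) = successively E p"
    by (simp only: successively_rev)
  then show "longest_path E S p \<Longrightarrow> longest_path E S (rev p)" by (simp add: longest_path_def)
qed

text \<open>Degree at least two within \<open>S\<close>; the negation covers both leaves and
  isolated vertices.\<close>

definition branching :: "('v \<Rightarrow> 'v \<Rightarrow> bool) \<Rightarrow> 'v set \<Rightarrow> 'v \<Rightarrow> bool" where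
  "branching E S v \<longleftrightarrow> (\<exists>u\<in>S. \<exists>u'\<in>S. E v u \<and> E v u' \<and> u \<noteq> u')"

text \<open>All neighbours of the first vertex lie on the path, since another one would prolong it;
  the second neighbour closes an initial segment.\<close>

lemma longest_path_hd_cycle:
  assumes "symp E" "irreflp E" "longest_path E S (v # p)" "branching E S v"
  shows "\<exists>vs r. v # p = vs @ r \<and> cycle_list E vs"
proof -
  have nb: "u \<in> set p" if "E v u" "u \<in> S" for u
  proof (rule ccontr)
    assume "u \<notin> set p"
    moreover have "u \<noteq> v" using that assms(2) by (auto dest: irreflpD)
    ultimately have "length (u # v # p) \<le> length (v # p)"
      using that longest_pathD(1-3)[OF assms(3)] sympD[OF assms(1) that(1)]
      by (intro longest_pathD(4)[OF assms(3)]) simp_all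
    then show False by simp
  qed
  obtain u u' where u: "u \<in> set p" "u' \<in> set p" "E v u" "E v u'" "u \<noteq> u'"
    using assms(4) nb unfolding branching_def by blast
  then obtain w q where p: "p = w # q" by (cases p) auto
  then obtain y where y: "y \<in> set q" "E v y" using u by auto
  then obtain s r where q: "q = s @ y # r" using split_list[OF y(1)] by blast
  have eq: "v # p = (v # w # s @ [y]) @ r" by (simp add: p q)
  have "distinct (v # w # s @ [y])" "successively E (v # w # s @ [y])"
    using longest_pathD(1,3)[OF assms(3)] unfolding eq successively_append_iff by auto
  then have "cycle_list E (v # w # s @ [y])"
    using sympD[OF assms(1) y(2)] by (simp add: cycle_list_def)
  with eq show ?thesis by blast
qed

text \<open>Otherwise both ends of a longest path would equal \<open>a\<close>, although the path
  has at least two vertices. The vertex \<open>a\<close> is exempted because a branch is to be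
  dismantled without its point of attachment.\<close>

lemma acyclic_on_leaf:
  assumes "symp E" "irreflp E" "finite S" "acyclic_on E S" "y \<in> S" "y \<noteq> a"
  shows "\<exists>y\<in>S. y \<noteq> a \<and> \<not> branching E S y"
proof (rule ccontr)
  assume "\<not> ?thesis"
  then have br: "branching E S y" if "y \<in> S" "y \<noteq> a" for y using that by blast
  obtain p where p: "longest_path E S p" using longest_path_exists[OF assms(3)] by blast
  have False if lp: "longest_path E S (v # q)" and va: "v \<noteq> a" for v q
  proof -
    have "v \<in> S" using longest_pathD(2)[OF lp] by simp
    then obtain vs r where vs: "v # q = vs @ r" "cycle_list E vs"
      using longest_path_hd_cycle[OF assms(1,2) lp br[OF _ va]] by blast
    have "set vs \<subseteq> S" using longest_pathD(2)[OF lp] unfolding vs(1) by simp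
    then show False using vs(2) assms(4) unfolding acyclic_on_def by blast
  qed
  note no = this
  obtain u where "u \<in> S" "E y u" using br[OF assms(5,6)] by (auto simp: branching_def)
  then have "length [y, u] \<le> length p"
    using assms(2,5) by (intro longest_pathD(4)[OF p]) (auto dest: irreflpD)
  then obtain v w q where pq: "p = v # q @ [w]"
    by (cases p; cases "tl p" rule: rev_cases) auto
  have "v \<noteq> w" using longest_pathD(1)[OF p] by (auto simp: pq)
  moreover have "longest_path E S (w # rev q @ [v])"
    using longest_path_rev[OF assms(1) p] by (simp add: pq)
  ultimately show False using no[of v "q @ [w]"] no[of w "rev q @ [v]"] p pq by auto
qed

text \<open>A longest path has a cycle at each of its ends; there is only one cycle, so it exhausts
  the path. A further vertex adjacent to it would prolong the path, the vertices not adjacent to it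
  would contain another cycle, and an extra edge would close a shorter one.\<close>

lemma unicyclic_branching_is_cycle:
  assumes "symp E" "irreflp E" "finite S" "S \<noteq> {}" "unicyclic_on E S"
    and br: "\<And>v. v \<in> S \<Longrightarrow> branching E S v"
  shows "\<exists>vs. cycle_list E vs \<and> set vs = S \<and>
    (\<forall>u\<in>S. \<forall>v\<in>S. E u v \<longleftrightarrow> {u, v} \<in> closed_walk_edges vs)"
proof -
  obtain p where p: "longest_path E S p" using longest_path_exists[OF assms(3)] by blast
  have cyc: "\<exists>vs r. q = vs @ r \<and> cycle_list E vs" if q: "longest_path E S q" for q
  proof (cases q)
    case Nil
    obtain v where "v \<in> S" using assms(4) by blast
    then have "length [v] \<le> length q" by (intro longest_pathD(4)[OF q]) simp_all
    then show ?thesis using Nil by simp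
  next
    case (Cons v r)
    then show ?thesis
      using longest_path_hd_cycle[OF assms(1,2), of S v r] q br longest_pathD(2)[OF q] by simp
  qed
  obtain vs r where vs: "p = vs @ r" "cycle_list E vs" using cyc[OF p] by blast
  obtain vs' r' where vs': "rev p = vs' @ r'" "cycle_list E vs'"
    using cyc[OF longest_path_rev[OF assms(1) p]] by blast
  have sub: "set vs \<subseteq> S" "set vs' \<subseteq> S"
    using longest_pathD(2)[OF p] vs vs' by (metis Un_subset_iff set_append set_rev)+
  have "r = []"
  proof (rule ccontr)
    assume "r \<noteq> []"
    then have "last p \<in> set r" by (simp add: vs)
    moreover have "vs' \<noteq> []" using vs' by (auto simp: cycle_list_def)
    then have "last p \<in> set vs'" using arg_cong[OF vs'(1), of hd] by (simp add: hd_rev)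
    ultimately have "last p \<in> set vs \<inter> set r"
      using unicyclic_on_vertices(2)[OF assms(5) vs(2) sub(1) vs'(2) sub(2)] by simp
    then show False using longest_pathD(1)[OF p] by (auto simp: vs)
  qed
  then have c: "cycle_list E p" using vs by simp
  have pS: "set p \<subseteq> S" using longest_pathD(2)[OF p] .
  have outside: "\<not> E u v" if u: "u \<in> S" "u \<notin> set p" and v: "v \<in> set p" for u v
  proof
    assume "E u v"
    obtain i where i: "i < length p" "p ! i = v" using v by (metis in_set_conv_nth)
    have "p \<noteq> []" using c by (auto simp: cycle_list_def)
    then have "hd (rotate i p) = v" using i hd_rotate_conv_nth[of p i] by simp
    then have "length (u # rotate i p) \<le> length p"
      using cycle_list_rotate[OF c, of i] u pS \<open>E u v\<close>
      by (intro longest_pathD(4)[OF p]) (auto simp: cycle_list_def successively_Cons)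
    then show False by simp
  qed
  have "set p = S"
  proof (rule ccontr)
    assume "set p \<noteq> S"
    then obtain y where y: "y \<in> S - set p" using pS by blast
    have p0: "p \<noteq> []" using c by (auto simp: cycle_list_def)
    have "branching E (S - set p) v" if "v \<in> S - set p" for v
      using br[of v] outside[of v] that unfolding branching_def by blast
    \<comment> \<open>\<open>hd p\<close> lies outside \<open>S - set p\<close>, so with it as the
      exempted vertex \<open>acyclic_on_leaf\<close> speaks about all vertices of this set.\<close>
    moreover have "y \<noteq> hd p" using y p0 by (metis DiffD2 hd_in_set)
    ultimately have "\<not> acyclic_on E (S - set p)"
      using acyclic_on_leaf[OF assms(1,2) finite_Diff[OF assms(3)] _ y] by meson
    then obtain us where us: "cycle_list E us" "set us \<subseteq> S - set p" by (auto simp: acyclic_on_def)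
    have "set us \<subseteq> S" using us(2) by blast
    then have "set us = set p" by (rule unicyclic_on_vertices(2)[OF assms(5) us(1) _ c pS])
    then have "set p \<subseteq> S - set p" using us(2) by simp
    then have "hd p \<in> S - set p" using hd_in_set[OF p0] by (rule subsetD)
    then show False using hd_in_set[OF p0] by simp
  qed
  moreover have "{u, v} \<in> closed_walk_edges p" if E: "E u v" "u \<in> S" "v \<in> S" for u v
  proof -
    obtain i where i: "i < length p" "p ! i = u" using E \<open>set p = S\<close> by (metis in_set_conv_nth)
    have p0: "p \<noteq> []" using c by (auto simp: cycle_list_def)
    then have "hd (rotate i p) = u" using i hd_rotate_conv_nth[of p i] by simp
    then obtain us where us: "rotate i p = u # us" using p0 by (metis list.collapse rotate_is_Nil_conv)
    have c': "cycle_list E (u # us)" using cycle_list_rotate[OF c, of i] us by simp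
    have sus: "set (u # us) = S" using \<open>set p = S\<close> us by (metis set_rotate)
    have eq: "closed_walk_edges (u # us) = closed_walk_edges p"
      using unicyclic_on_vertices(1)[OF assms(5) c' _ c pS] sus by blast
    have "v \<noteq> u" using E assms(2) by (auto dest: irreflpD)
    then have "v \<in> set us" using sus E by auto
    then obtain q r where q: "us = q @ v # r" by (metis split_list)
    show ?thesis
    proof (cases "q = [] \<or> r = []")
      case True
      then show ?thesis
      proof
        assume "q = []"
        then show ?thesis using closed_walk_edges_hd[of u v r] unfolding eq[symmetric] q by simp
      next
        assume "r = []"
        then show ?thesis
          using closed_walk_edges_last[of u us] unfolding eq[symmetric] q
          by (simp add: insert_commute)
      qed
    next
      case False
      \<comment> \<open>With vertices left on both sides, the edge from \<open>u\<close> to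
        \<open>v\<close> would close a cycle that misses \<open>hd r\<close>.\<close>
      have us': "u # us = (u # q @ [v]) @ r" by (simp add: q)
      have "distinct (u # q @ [v])" "successively E (u # q @ [v])"
        using c' unfolding us' cycle_list_def successively_append_iff by auto
      then have "cycle_list E (u # q @ [v])"
        using sympD[OF assms(1) E(1)] False by (cases q) (simp_all add: cycle_list_def)
      moreover have "set (u # q @ [v]) \<subseteq> S" using sus q by auto
      ultimately have "set (u # q @ [v]) = set (u # us)"
        using unicyclic_on_vertices(2)[OF assms(5) _ _ c'] sus by blast
      moreover have "hd r \<notin> set (u # q @ [v])" "hd r \<in> set (u # us)"
        using c' False by (cases r; auto simp: cycle_list_def q)+
      ultimately show ?thesis by blast
    qed
  qed
  ultimately show ?thesis using c cycle_list_edge[OF c assms(1)] by blast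
qed

section \<open>Absorbing leaves\<close>

lemma symp_crossing: "symp (crossing w)"
  by (rule sympI) (simp add: crossing_commute)

lemma irreflp_crossing: "irreflp (crossing w)"
  by (rule irreflpI) (simp add: crossing_def)

lemma crossing_rot: "crossing (u @ v) = crossing (v @ u)"
proof -
  have "crossing (s @ t) a b \<Longrightarrow> crossing (t @ s) a b" for s t a b
    using crossing_rotate_imp[of "s @ t" a b "length s"] by (simp add: rotate_append)
  then show ?thesis by (auto simp: fun_eq_iff)
qed

lemma crossing_filter: "P a \<Longrightarrow> P b \<Longrightarrow> crossing (filter P w) a b \<longleftrightarrow> crossing w a b"
proof -
  assume "P a" "P b"
  then have "filter (\<lambda>c. c \<in> {a, b}) (filter P w) = filter (\<lambda>c. c \<in> {a, b}) w"
    by (simp only: filter_filter) (rule filter_cong, auto)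
  then show ?thesis by (simp only: crossing_def)
qed

lemma filter_pair_absent:
  "a \<notin> set w \<Longrightarrow> a \<noteq> b \<Longrightarrow> filter (\<lambda>c. c \<in> {a, b}) w = replicate (count_list w b) b"
  by (induction w) auto

lemma gauss_word_counts:
  assumes "gauss_word (x # U @ x # V)" "b \<noteq> x"
  shows "count_list U b + count_list V b = 0 \<or> count_list U b + count_list V b = 2"
proof -
  have "count_list (x # U @ x # V) b = 0 \<or> count_list (x # U @ x # V) b = 2"
    using assms(1) unfolding gauss_word_def by (metis count_list_0_iff)
  then show ?thesis using assms(2) by auto
qed

lemma crossing_chord:
  assumes "gauss_word (x # U @ x # V)"
  shows "crossing (x # U @ x # V) x b \<longleftrightarrow> b \<in> set U \<and> b \<in> set V"
proof (cases "b = x")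
  case True
  then show ?thesis using gauss_word_two[of "[]" x U V] assms by (simp add: crossing_def)
next
  case False
  have x: "x \<notin> set U" "x \<notin> set V" using gauss_word_two[of "[]" x U V] assms by auto
  have 1: "filter (\<lambda>c. c \<in> {x, b}) (x # U @ x # V)
      = x # replicate (count_list U b) b @ x # replicate (count_list V b) b"
    using x False by (simp add: filter_pair_absent[simplified])
  have "b \<in> set U \<longleftrightarrow> count_list U b \<noteq> 0" "b \<in> set V \<longleftrightarrow> count_list V b \<noteq> 0"
    by (simp_all add: count_list_0_iff)
  note b = this
  consider "count_list U b = 0" "count_list V b = 0" | "count_list U b = 0" "count_list V b = 2"
    | "count_list U b = 1" "count_list V b = 1" | "count_list U b = 2" "count_list V b = 0"
    using gauss_word_counts[OF assms False] by linarith
  then show ?thesis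
    unfolding crossing_def 1 using False by cases (simp_all add: numeral_2_eq_2 b)
qed

text \<open>All ends of \<open>a\<close> lie in \<open>U\<close> and all ends of \<open>b\<close> in
  \<open>V\<close>, so they cannot alternate.\<close>

lemma crossing_same_side:
  assumes "gauss_word (x # U @ x # V)" "a \<notin> set V" "b \<notin> set U" "a \<noteq> x" "b \<noteq> x"
  shows "\<not> crossing (x # U @ x # V) a b"
proof
  assume cr: "crossing (x # U @ x # V) a b"
  then have ab: "a \<noteq> b" by (simp add: crossing_def)
  have "filter (\<lambda>c. c \<in> {a, b}) (x # U @ x # V)
      = filter (\<lambda>c. c \<in> {b, a}) U @ filter (\<lambda>c. c \<in> {a, b}) V"
    using assms(4,5) by (auto simp: insert_commute)
  also have "\<dots> = replicate (count_list U a) a @ replicate (count_list V b) b"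
    by (simp only: filter_pair_absent[OF assms(3) ab[symmetric]] filter_pair_absent[OF assms(2) ab])
  finally have eq: "filter (\<lambda>c. c \<in> {a, b}) (x # U @ x # V) = \<dots>" .
  have "count_list U a = 0 \<or> count_list U a = 2" "count_list V b = 0 \<or> count_list V b = 2"
    using gauss_word_counts[OF assms(1,4)] gauss_word_counts[OF assms(1,5)] assms(2,3)
    by (simp_all add: count_list_0_iff)
  then show False
    using cr ab unfolding crossing_def eq by (elim disjE) (simp_all add: numeral_2_eq_2)
qed

lemma crossing_remove:
  assumes "gauss_word (x # U @ x # V)"
  shows "crossing (U @ V) a b \<longleftrightarrow> crossing (x # U @ x # V) a b \<and> a \<noteq> x \<and> b \<noteq> x"
proof -
  have x: "x \<notin> set U" "x \<notin> set V" using gauss_word_two[of "[]" x U V] assms by auto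
  have "filter (\<lambda>c. c \<noteq> x) U = U" "filter (\<lambda>c. c \<noteq> x) V = V"
    by (rule filter_True, use x in blast)+
  then have "filter (\<lambda>c. c \<noteq> x) (x # U @ x # V) = U @ V" by simp
  then show ?thesis
    using crossing_filter[of "\<lambda>c. c \<noteq> x" a b "x # U @ x # V"] crossing_in_set[of "U @ V" a b] x by auto
qed

lemma gauss_word_remove: "gauss_word (x # U @ x # V) \<Longrightarrow> gauss_word (U @ V)"
  using gauss_word_appendD(3)[of "x # U @ x # V" "[x, x]" "U @ V"] by (simp add: even_word_def)

lemma cycle_list_mono:
  "cycle_list E' vs \<Longrightarrow> (\<And>a b. E' a b \<Longrightarrow> E a b) \<Longrightarrow> cycle_list E vs"
  unfolding cycle_list_def using successively_mono[of E' vs E] by blast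

lemma acyclic_on_mono:
  "acyclic_on E S \<Longrightarrow> (\<And>a b. E' a b \<Longrightarrow> E a b) \<Longrightarrow> S' \<subseteq> S \<Longrightarrow> acyclic_on E' S'"
  unfolding acyclic_on_def using cycle_list_mono[of E' _ E] by blast

lemma unicyclic_on_mono:
  assumes "unicyclic_on E S" "\<And>a b. E' a b \<Longrightarrow> E a b" "S' \<subseteq> S"
  shows "unicyclic_on E' S'"
  unfolding unicyclic_on_def
proof (intro allI impI)
  fix vs vs'
  assume "cycle_list E' vs \<and> set vs \<subseteq> S' \<and> cycle_list E' vs' \<and> set vs' \<subseteq> S'"
  moreover have "cycle_list E us" if "cycle_list E' us" for us
    using cycle_list_mono[of E' us E] that assms(2) by blast
  ultimately have "cycle_list E vs" "cycle_list E vs'" "set vs \<subseteq> S" "set vs' \<subseteq> S"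
    using assms(3) by blast+
  then show "closed_walk_edges vs = closed_walk_edges vs'"
    using unicyclic_on_vertices(1)[OF assms(1)] by blast
qed

section \<open>Absorbing one leaf\<close>

lemma graft_commute:
  assumes "a \<noteq> b" "x \<noteq> b" "y \<noteq> a"
  shows "graft (graft d y b) x a = graft (graft d x a) y b"
  using assms by (simp add: graft_def fun_upd_twist)

context four_term_function
begin

text \<open>Two leaves on the same chord give two branches whose nesting depends on the order of the
  grafts; there the interchange of branches is needed.\<close>

lemma val_graft_commute:
  assumes "branch_decoration d" "x \<noteq> b" "y \<noteq> a"
  shows "val (graft (graft d y b) x a) z w = val (graft (graft d x a) y b) z w"
proof (cases "a = b")
  case True
  have "branches (fst (d t) @ t # snd (d t)) [t]" for t
    by (rule branches.root[OF branch_decorationD[OF assms(1)]])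
  from val_swap_decorations[OF this this, of d a x y "fst (d a)" "snd (d a)" z w]
  show ?thesis using True assms by (simp add: graft_def)
qed (use assms graft_commute in simp)

text \<open>Induction on the length of \<open>U\<close>. If \<open>U\<close> is just an end of
  \<open>a\<close>, the leaf is adjacent to it. Otherwise the forest on \<open>U\<close> has a leaf
  or isolated vertex \<open>y\<close> other than \<open>a\<close>, with both ends in
  \<open>U\<close>: remove \<open>y\<close>, absorb \<open>x\<close> over the shorter arc, and put
  \<open>y\<close> back in the word without \<open>x\<close>.\<close>

lemma val_leaf:
  assumes "gauss_word (x # U @ x # V)" "set U \<inter> set V = {a}"
    and "acyclic_on (crossing (x # U @ x # V)) (set U)" "branch_decoration d" "even_word z"
  shows "val d z (x # U @ x # V) = val (graft d x a) z (U @ V)"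
  using assms
proof (induction "length U" arbitrary: x U V a d z rule: less_induct)
  case less
  note g = less.prems(1) and UV = less.prems(2) and ac = less.prems(3) and d = less.prems(4)
    and z = less.prems(5)
  have x: "x \<notin> set U" "x \<notin> set V" using gauss_word_two[of "[]" x U V] g by auto
  then have ax: "a \<noteq> x" using UV by auto
  have cUV: "count_list U a \<noteq> 0" "count_list V a \<noteq> 0" using UV by (auto simp: count_list_0_iff)
  then have cU: "count_list U a = 1" using gauss_word_counts[OF g ax] by linarith
  show ?case
  proof (cases "set U = {a}")
    case True
    then have "U = replicate (length U) a" using replicate_length_same[of U a] by simp
    moreover have "count_list (replicate n a) a = n" for n by (induction n) auto
    ultimately have "length U = 1" using cU by metis
    then have "U = [a]" using True by (cases U) auto
    then show ?thesis using val_leaf_adjacent[of x a V d z] g ax by simp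
  next
    case False
    then obtain y0 where "y0 \<in> set U" "y0 \<noteq> a" using UV by blast
    then obtain y where y: "y \<in> set U" "y \<noteq> a" "\<not> branching (crossing (x # U @ x # V)) (set U) y"
      using acyclic_on_leaf[OF symp_crossing irreflp_crossing finite_set ac] by blast
    have yx: "y \<noteq> x" "y \<notin> set V" using y x UV by auto
    have cy: "count_list U y = 2"
      using gauss_word_counts[OF g yx(1)] y(1) yx(2) by (simp add: count_list_0_iff)
    obtain U1 T where "U = U1 @ y # T" "y \<notin> set U1" using y(1) by (metis split_list_first)
    moreover then have "count_list T y \<noteq> 0" using cy by (simp add: count_list_0_iff)
    then have "y \<in> set T" by (simp add: count_list_0_iff)
    then obtain Y U2 where "T = Y @ y # U2" by (metis split_list)
    ultimately have U: "U = U1 @ y # Y @ y # U2" by simp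
    \<comment> \<open>\<open>R\<close> and \<open>R2\<close> are the arcs of \<open>y\<close>
      opposite to \<open>Y\<close>, before and after the removal of \<open>x\<close>;
      \<open>U'\<close> is \<open>U\<close> without \<open>y\<close>.\<close>
    define R R2 U' where "R = U2 @ x # V @ x # U1" and "R2 = U2 @ V @ U1" and "U' = U1 @ Y @ U2"
    have rotw: "x # U @ x # V = (x # U1) @ (y # Y @ y # U2 @ x # V)"
      "y # Y @ y # R = (y # Y @ y # U2 @ x # V) @ (x # U1)" by (simp_all add: U R_def)
    have rotw': "x # U' @ x # V = (x # U1) @ (Y @ U2 @ x # V)"
      "Y @ R = (Y @ U2 @ x # V) @ (x # U1)" by (simp_all add: U'_def R_def)
    have rotu: "U @ V = U1 @ (y # Y @ y # U2 @ V)" "y # Y @ y # R2 = (y # Y @ y # U2 @ V) @ U1"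
      by (simp_all add: U R2_def)
    have rotu': "U' @ V = U1 @ (Y @ U2 @ V)" "Y @ R2 = (Y @ U2 @ V) @ U1"
      by (simp_all add: U'_def R2_def)
    have gR: "gauss_word (y # Y @ y # R)" using g gauss_word_rot unfolding rotw by blast
    have gYR: "gauss_word (Y @ R)" by (rule gauss_word_remove[OF gR])
    then have gw': "gauss_word (x # U' @ x # V)" unfolding rotw' by (rule gauss_word_rot)
    have gUV: "gauss_word (U @ V)" by (rule gauss_word_remove[OF g])
    then have gR2: "gauss_word (y # Y @ y # R2)" using gauss_word_rot unfolding rotu by blast
    have gYR2: "gauss_word (Y @ R2)" by (rule gauss_word_remove[OF gR2])
    have yY: "y \<notin> set Y" using gauss_word_two[of "[]" y Y R] gR by simp
    have crR: "crossing (y # Y @ y # R) = crossing (x # U @ x # V)"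
      unfolding rotw by (rule crossing_rot)
    have crR2: "crossing (y # Y @ y # R2) = crossing (U @ V)"
      unfolding rotu by (rule crossing_rot)
    have crw': "crossing (x # U' @ x # V) = crossing (Y @ R)"
      unfolding rotw' by (rule crossing_rot)
    have YR2: "set Y \<inter> set R2 = set Y \<inter> set R" using x by (auto simp: R_def R2_def U)
    have dx: "branch_decoration (graft d x a)" by (rule branch_decoration_graft[OF d])
    have U'V: "set U' \<inter> set V = {a}" using UV y(2) yx(2) by (auto simp: U'_def U)
    have acU': "acyclic_on (crossing (x # U' @ x # V)) (set U')"
      using acyclic_on_mono[OF ac, of "crossing (x # U' @ x # V)" "set U'"]
        crossing_remove[OF gR] crR crw' by (auto simp: U'_def U)
    have lenU': "length U' < length U" by (simp add: U'_def U)
    note step = less.hyps[OF lenU' gw' U'V acU']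
    have nb: "b \<in> set U \<and> crossing (x # U @ x # V) y b" if "b \<in> set Y \<inter> set R" for b
      using that crossing_chord[OF gR, of b] crR by (auto simp: U)
    show ?thesis
    proof (cases "set Y \<inter> set R = {}")
      case True
      \<comment> \<open>An isolated \<open>y\<close> is parked in \<open>z'\<close> with its
        branches until \<open>x\<close> is grafted. As \<open>y\<close> differs from
        \<open>a\<close>, the graft leaves its decoration unchanged.\<close>
      define z' where "z' = fst (d y) @ y # snd (d y) @ [y] @ z"
      note iso = val_isolated[OF d z gR True]
      have z': "even_word z'" using iso(2) by (simp add: z'_def)
      have gd: "graft d x a y = d y" using y(2) by (simp add: graft_def)
      have "val d z (x # U @ x # V) = val d z (y # Y @ y # R)"
        unfolding rotw by (rule val_rot[OF d z]) (use g rotw in simp)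
      also have "\<dots> = val d z' (Y @ R)" using iso(1) by (simp add: z'_def)
      also have "\<dots> = val d z' (x # U' @ x # V)"
        unfolding rotw' by (rule val_rot[OF d z']) (use gYR rotw' in simp)
      also have "\<dots> = val (graft d x a) z' (U' @ V)" by (rule step[OF d z'])
      also have "\<dots> = val (graft d x a) z' (Y @ R2)"
        unfolding rotu' by (rule val_rot[OF dx z', symmetric]) (use gYR2 rotu' in simp)
      also have "\<dots> = val (graft d x a) z (y # Y @ y # R2)"
        using val_isolated(1)[OF dx z gR2] True YR2 gd by (simp add: z'_def)
      also have "\<dots> = val (graft d x a) z (U @ V)"
        unfolding rotu by (rule val_rot[OF dx z]) (use gR2 rotu in simp)
      finally show ?thesis .
    next
      case False
      then obtain b where "b \<in> set Y \<inter> set R" by blast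
      then have b: "set Y \<inter> set R = {b}" using y(3) nb unfolding branching_def by blast
      have bx: "x \<noteq> b" using b x by (auto simp: U)
      \<comment> \<open>The induction hypothesis is used three times: with the arc \<open>Y\<close>
        to absorb \<open>y\<close>, with \<open>U'\<close> to absorb \<open>x\<close>, and with
        \<open>Y\<close> backwards, in the word without \<open>x\<close>, to restore
        \<open>y\<close>.\<close>
      have lenY: "length Y < length U" by (simp add: U)
      have acY: "acyclic_on (crossing (y # Y @ y # R)) (set Y)"
        unfolding crR by (rule acyclic_on_mono[OF ac]) (auto simp: U)
      have acY2: "acyclic_on (crossing (y # Y @ y # R2)) (set Y)"
        unfolding crR2 by (rule acyclic_on_mono[OF ac]) (auto simp: U[symmetric] crossing_remove[OF g], simp add: U)
      have dy: "branch_decoration (graft d y b)" by (rule branch_decoration_graft[OF d])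
      have dxy: "branch_decoration (graft (graft d x a) y b)" by (rule branch_decoration_graft[OF dx])
      have "val d z (x # U @ x # V) = val d z (y # Y @ y # R)"
        unfolding rotw by (rule val_rot[OF d z]) (use g rotw in simp)
      also have "\<dots> = val (graft d y b) z (Y @ R)"
        by (rule less.hyps[OF lenY gR b acY d z])
      also have "\<dots> = val (graft d y b) z (x # U' @ x # V)"
        unfolding rotw' by (rule val_rot[OF dy z]) (use gYR rotw' in simp)
      also have "\<dots> = val (graft (graft d y b) x a) z (U' @ V)" by (rule step[OF dy z])
      also have "\<dots> = val (graft (graft d x a) y b) z (U' @ V)"
        by (rule val_graft_commute[OF d bx y(2)])
      also have "\<dots> = val (graft (graft d x a) y b) z (Y @ R2)"
        unfolding rotu' by (rule val_rot[OF dxy z, symmetric]) (use gYR2 rotu' in simp)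
      also have "\<dots> = val (graft d x a) z (y # Y @ y # R2)"
        by (rule less.hyps[OF lenY gR2 _ acY2 dx z, symmetric]) (use YR2 b in simp)
      also have "\<dots> = val (graft d x a) z (U @ V)"
        unfolding rotu by (rule val_rot[OF dx z]) (use gR2 rotu in simp)
      finally show ?thesis .
    qed
  qed
qed

text \<open>Cycles on both sides of \<open>x\<close> would have the same vertices, hence lie in
  \<open>{a}\<close>. So one side is a forest, and a rotation exchanges the sides.\<close>

lemma val_leaf_unicyclic:
  assumes g: "gauss_word (x # U @ x # V)" and UV: "set U \<inter> set V = {a}"
    and uni: "unicyclic_on (crossing (x # U @ x # V)) (set (x # U @ x # V))"
    and d: "branch_decoration d" and z: "even_word z"
  shows "val d z (x # U @ x # V) = val (graft d x a) z (U @ V)"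
proof (cases "acyclic_on (crossing (x # U @ x # V)) (set U)")
  case True
  then show ?thesis using val_leaf assms by blast
next
  case False
  then obtain vs where vs: "cycle_list (crossing (x # U @ x # V)) vs" "set vs \<subseteq> set U"
    by (auto simp: acyclic_on_def)
  have cr: "crossing (x # V @ x # U) = crossing (x # U @ x # V)"
    using crossing_rot[of "x # U" "x # V"] by simp
  have acV: "acyclic_on (crossing (x # V @ x # U)) (set V)" unfolding cr
  proof (rule ccontr)
    assume "\<not> acyclic_on (crossing (x # U @ x # V)) (set V)"
    then obtain vs' where vs': "cycle_list (crossing (x # U @ x # V)) vs'" "set vs' \<subseteq> set V"
      by (auto simp: acyclic_on_def)
    have "set vs \<subseteq> set (x # U @ x # V)" "set vs' \<subseteq> set (x # U @ x # V)" using vs vs' by auto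
    then have "set vs = set vs'" using unicyclic_on_vertices(2)[OF uni vs(1) _ vs'(1)] by blast
    then have "set vs \<subseteq> {a}" using vs(2) vs'(2) UV by blast
    then have "card (set vs) \<le> 1" using card_mono[of "{a}" "set vs"] by simp
    then show False using vs(1) by (simp add: cycle_list_def distinct_card)
  qed
  have g': "gauss_word (x # V @ x # U)" using gauss_word_rot[of "x # U" "x # V"] g by simp
  have VU: "set V \<inter> set U = {a}" using UV by blast
  have "val d z (x # U @ x # V) = val d z (x # V @ x # U)"
    using val_rot[OF d z, of "x # U" "x # V"] g by simp
  also have "\<dots> = val (graft d x a) z (V @ U)"
    by (rule val_leaf[OF g' VU acV d z])
  also have "\<dots> = val (graft d x a) z (U @ V)"
    by (rule val_rot[OF branch_decoration_graft[OF d] z gauss_word_remove[OF g']])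
  finally show ?thesis .
qed

end

section \<open>Diagrams whose intersection graph is a cycle\<close>

text \<open>
  The intersection graph of \<open>w\<close> is the cycle \<open>c 0, ..., c (m - 1)\<close>; the indices are integers
  modulo \<open>m\<close>.
\<close>

definition cyclic_crossing :: "nat list \<Rightarrow> (int \<Rightarrow> nat) \<Rightarrow> nat \<Rightarrow> bool" where
  "cyclic_crossing w c m \<longleftrightarrow> 3 \<le> m \<and> (\<forall>a b. c a = c b \<longleftrightarrow> int m dvd a - b) \<and> set w = range c \<and>
     (\<forall>a b. crossing w (c a) (c b) \<longleftrightarrow> int m dvd a - b - 1 \<or> int m dvd b - a - 1)"

text \<open>For \<open>k = m\<close> this is the cyclic word
  \<open>c 0, c (m - 1), c 1, c 0, c 2, c 1, ...\<close>, in which each chord is interlaced with its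
  two neighbours. Passing from \<open>c\<close> to \<open>c \<circ> uminus\<close> gives the mirror
  image up to rotation.\<close>

definition ring_word :: "(int \<Rightarrow> nat) \<Rightarrow> nat \<Rightarrow> nat list" where
  "ring_word c k = concat (map (\<lambda>i. [c (int i), c (int i - 1)]) [0..<k])"

lemma ring_word_Suc: "ring_word c (Suc k) = ring_word c k @ [c (int k), c (int k - 1)]"
  by (simp add: ring_word_def)

lemma ring_word_0: "ring_word c 0 = []"
  by (simp add: ring_word_def)

lemma length_ring_word: "length (ring_word c k) = 2 * k"
  by (induction k) (simp_all add: ring_word_0 ring_word_Suc)

lemma map_ring_word: "map g (ring_word c k) = ring_word (g \<circ> c) k"
  by (simp add: ring_word_def map_concat comp_def)

lemma dvd_int_small: "\<bar>x\<bar> < int m \<Longrightarrow> int m dvd x \<longleftrightarrow> x = 0"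
  by (metis dvd_0_right dvd_imp_le_int linorder_not_le abs_of_nat)

lemma gauss_word_length:
  assumes "gauss_word w" shows "length w = 2 * card (set w)"
proof -
  have "(\<Sum>a\<in>set w. count_list w a) = length w" by (rule sum_count_set) auto
  moreover have "(\<Sum>a\<in>set w. count_list w a) = (\<Sum>a\<in>set w. 2)"
    by (rule sum.cong) (use assms in \<open>auto simp: gauss_word_def\<close>)
  ultimately show ?thesis by simp
qed

context
  fixes w c m
  assumes cc: "cyclic_crossing w c m"
begin

lemma cc_facts:
  "3 \<le> m" "c a = c b \<longleftrightarrow> int m dvd a - b" "set w = range c"
  "crossing w (c a) (c b) \<longleftrightarrow> int m dvd a - b - 1 \<or> int m dvd b - a - 1"
  using cc by (simp_all add: cyclic_crossing_def)

lemma cc_index: "\<exists>j<m. c i = c (a + int j)"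
proof -
  have "c i = c (a + (i - a) mod int m)"
    unfolding cc_facts(2) by (simp add: mod_eq_dvd_iff[symmetric] mod_simps)
  moreover have "nat ((i - a) mod int m) < m" using cc_facts(1)
    by (simp add: nat_less_iff)
  ultimately show ?thesis using cc_facts(1)
    by (intro exI[of _ "nat ((i - a) mod int m)"]) simp
qed

lemma card_range_cyclic: "card (range c) = m"
proof -
  have "range c = (\<lambda>j. c (int j)) ` {..<m}"
    using cc_index[of _ 0] by (auto simp: image_iff)
  moreover have "inj_on (\<lambda>j. c (int j)) {..<m}"
    by (rule inj_onI) (simp add: cc_facts(2) dvd_int_small)
  ultimately show ?thesis by (simp add: card_image)
qed

lemma cyclic_crossing_reflect: "cyclic_crossing w (c \<circ> uminus) m"
proof -
  have "range (c \<circ> uminus) = range c"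
    by (metis fun.set_map surj_uminus)
  moreover have "int m dvd - a - - b \<longleftrightarrow> int m dvd a - b" for a b
    by (metis dvd_minus_iff minus_diff_commute minus_diff_eq minus_minus diff_minus_eq_add add.commute uminus_add_conv_diff)
  moreover have "int m dvd - a - - b - 1 \<longleftrightarrow> int m dvd b - a - 1" for a b
    by (simp add: algebra_simps)
  ultimately show ?thesis using cc_facts unfolding cyclic_crossing_def by auto
qed

end

lemma cyclic_crossing_cong:
  "cyclic_crossing w c m \<Longrightarrow> crossing w' = crossing w \<Longrightarrow> set w' = set w \<Longrightarrow> cyclic_crossing w' c m"
  by (simp add: cyclic_crossing_def)

lemma mset_pair:
  assumes "mset v = {#s, t#}" shows "v = [s, t] \<or> v = [t, s]"
proof -
  have "length v = 2" using arg_cong[OF assms, of size] by simp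
  then obtain p q where "v = [p, q]"
    by (metis (no_types, opaque_lifting) One_nat_def Suc_1 length_0_conv length_Suc_conv)
  then show ?thesis using assms by (auto simp: add_eq_conv_ex)
qed

text \<open>The chords other than \<open>c i\<close> and its two neighbours form a path that does
  not meet \<open>c i\<close>, so they lie on one side of it; the other arc contains one end of each
  neighbour and nothing else. For \<open>m = 3\<close> there are no further chords.\<close>

lemma short_arc:
  assumes cc: "cyclic_crossing (x # U @ x # V) c m" and g: "gauss_word (x # U @ x # V)"
    and x: "x = c i"
  defines "arcs \<equiv> {[c (i - 1), c (i + 1)], [c (i + 1), c (i - 1)]}"
  shows "U \<in> arcs \<or> V \<in> arcs" "m = 3 \<Longrightarrow> U \<in> arcs"
proof -
  note f = cc_facts[OF cc]
  let ?w = "x # U @ x # V"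
  have ne: "c (i - 1) \<noteq> c (i + 1)" "c (i - 1) \<noteq> x" "c (i + 1) \<noteq> x"
    using f(1) by (simp_all add: x f(2) dvd_int_small)
  have nb: "b \<in> set U \<and> b \<in> set V \<longleftrightarrow> crossing ?w x b" for b
    using crossing_chord[OF g] by simp
  have "crossing ?w (c i) (c (i - 1))" "crossing ?w (c i) (c (i + 1))"
    unfolding f(4) by simp_all
  then have "crossing ?w x (c (i - 1))" "crossing ?w x (c (i + 1))" by (simp_all only: x)
  then have both: "c (i - 1) \<in> set U" "c (i - 1) \<in> set V" "c (i + 1) \<in> set U" "c (i + 1) \<in> set V"
    using nb by blast+
  have one: "count_list U b = 1" "count_list V b = 1" if "b \<in> {c (i - 1), c (i + 1)}" for b
  proof -
    have "count_list U b \<noteq> 0" "count_list V b \<noteq> 0" using that both by (auto simp: count_list_0_iff)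
    moreover have "b \<noteq> x" using that ne by auto
    ultimately show "count_list U b = 1" "count_list V b = 1"
      using gauss_word_counts[OF g, of b] by linarith+
  qed
  \<comment> \<open>Counted from \<open>i\<close>, the indices from 2 to \<open>m - 2\<close> are
    the chords that do not meet \<open>c i\<close>; the index \<open>m - 1\<close> is the neighbour
    \<open>c (i - 1)\<close>.\<close>
  have arc: "T \<in> arcs" if T: "T = U \<or> T = V" and no: "\<And>j. 2 \<le> j \<Longrightarrow> j \<le> m - 2 \<Longrightarrow> c (i + int j) \<notin> set T"
    for T
  proof -
    have sub: "set T \<subseteq> {c (i - 1), c (i + 1)}"
    proof
      fix b assume b: "b \<in> set T"
      then have "b \<in> set ?w" using T by auto
      then obtain k where "b = c k" using f(3) by auto
      then obtain j where j: "j < m" "b = c (i + int j)" using cc_index[OF cc, of k i] by auto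
      have "x \<notin> set T" using gauss_word_two[of "[]" x U V] g T by auto
      then have "j \<noteq> 0" using b j x by (intro notI) simp
      moreover have "\<not> (2 \<le> j \<and> j \<le> m - 2)" using no[of j] b j by auto
      ultimately have "j = 1 \<or> j = m - 1" using j(1) by linarith
      moreover have "c (i + int (m - 1)) = c (i - 1)" using f(1) by (simp add: f(2) of_nat_diff)
      ultimately show "b \<in> {c (i - 1), c (i + 1)}" using j(2) by auto
    qed
    have "mset T = {#c (i - 1), c (i + 1)#}"
    proof (rule multiset_eqI)
      fix b
      show "count (mset T) b = count {#c (i - 1), c (i + 1)#} b"
      proof (cases "b \<in> {c (i - 1), c (i + 1)}")
        case True
        then have "count_list T b = 1" using one[of b] T by auto
        then show ?thesis using True ne(1) by (auto simp: count_list_mset)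
      next
        case False
        then have "b \<notin> set T" using sub by blast
        then show ?thesis using False by (auto simp: not_in_iff)
      qed
    qed
    from mset_pair[OF this] show ?thesis by (simp add: arcs_def)
  qed
  show "m = 3 \<Longrightarrow> U \<in> arcs" by (rule arc) auto
  have single: "c (i + int j) \<notin> set U \<or> c (i + int j) \<notin> set V" "c (i + int j) \<noteq> x"
    "c (i + int j) \<in> set U \<union> set V"
    if "2 \<le> j" "j \<le> m - 2" for j
  proof -
    have "\<not> int m dvd - int j" "\<not> int m dvd - int j - 1" "\<not> int m dvd int j - 1"
      using that f(1) by (subst dvd_int_small; linarith)+
    then have "\<not> crossing ?w (c i) (c (i + int j))" and "c (i + int j) \<noteq> c i"
      unfolding f(2) f(4) by (simp_all add: algebra_simps)
    then have "\<not> crossing ?w x (c (i + int j))" and nx: "c (i + int j) \<noteq> x"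
      by (simp_all only: x not_False_eq_True)
    then show "c (i + int j) \<notin> set U \<or> c (i + int j) \<notin> set V" "c (i + int j) \<noteq> x"
      using nb by auto
    have "c (i + int j) \<in> set ?w" using f(3) by simp
    then show "c (i + int j) \<in> set U \<union> set V" using nx by auto
  qed
  have same: "c (i + int j) \<in> set T \<longleftrightarrow> c (i + 2) \<in> set T"
    if "2 \<le> j" "j \<le> m - 2" "T = U \<or> T = V" for j T
    using that
  proof (induction j rule: dec_induct)
    case (step k)
    have "crossing ?w (c (i + int k)) (c (i + int (Suc k)))" by (simp add: f(4))
    moreover have "crossing ?w (c (i + int (Suc k))) (c (i + int k))" by (simp add: f(4))
    moreover have k: "2 \<le> k" "k \<le> m - 2" "2 \<le> Suc k" "Suc k \<le> m - 2" using step by auto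
    ultimately have "c (i + int k) \<in> set U \<longleftrightarrow> c (i + int (Suc k)) \<in> set U"
      "c (i + int k) \<in> set V \<longleftrightarrow> c (i + int (Suc k)) \<in> set V"
      using crossing_same_side[OF g] single[OF k(1,2)] single[OF k(3,4)] by blast+
    then show ?case using step by auto
  qed simp
  show "U \<in> arcs \<or> V \<in> arcs"
  proof (cases "2 \<le> m - 2 \<and> c (i + 2) \<in> set U")
    case True
    then have "c (i + 2) \<notin> set V" using single(1)[of 2] by auto
    then have "V \<in> arcs" using same by (intro arc) auto
    then show ?thesis ..
  next
    case False
    then have "U \<in> arcs" using same by (intro arc) auto
    then show ?thesis ..
  qed
qed

text \<open>The prefix contains only the first end of \<open>c k\<close>. The short arc of
  \<open>c k\<close> begins with \<open>c (k - 1)\<close>, so it continues with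
  \<open>c (k + 1)\<close> and then reaches the second end of \<open>c k\<close>.\<close>

lemma ring_word_prefix:
  assumes cc: "cyclic_crossing (ring_word c (Suc k) @ v) c m"
    and g: "gauss_word (ring_word c (Suc k) @ v)" and k: "1 \<le> k" "Suc k < m"
  shows "\<exists>v'. v = c (int (Suc k)) # c (int k) # v'"
proof -
  note f = cc_facts[OF cc]
  let ?p = "ring_word c k"
  let ?r = "c (int k) # c (int k - 1) # v @ ?p"
  have eq: "ring_word c (Suc k) @ v = ?p @ (c (int k) # c (int k - 1) # v)" "?r = (c (int k) # c (int k - 1) # v) @ ?p"
    by (simp_all add: ring_word_Suc)
  have gr: "gauss_word ?r" using g gauss_word_rot unfolding eq by blast
  have cr: "crossing ?r = crossing (ring_word c (Suc k) @ v)" unfolding eq by (rule crossing_rot)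
  have ccr: "cyclic_crossing ?r c m"
    by (rule cyclic_crossing_cong[OF cc cr]) (auto simp: ring_word_Suc)
  have set_p: "set (ring_word c n) \<subseteq> c ` {- 1..int n - 1}" for n
    by (induction n) (auto simp: ring_word_0 ring_word_Suc intro!: imageI)
  have "c (int k) \<notin> set ?p"
  proof
    assume "c (int k) \<in> set ?p"
    then have "c (int k) \<in> c ` {- 1..int k - 1}" using set_p[of k] by (rule rev_subsetD)
    then obtain j where j: "- 1 \<le> j" "j \<le> int k - 1" "c (int k) = c j" by auto
    then have "int m dvd int k - j" by (simp add: f(2))
    moreover have "\<bar>int k - j\<bar> < int m" using j k by linarith
    ultimately show False using j(2) by (simp add: dvd_int_small)
  qed
  note cp = this
  have kk: "c (int k) \<noteq> c (int k - 1)" "c (int k - 1) \<noteq> c (int k + 1)"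
    using k f(1) by (simp_all add: f(2) dvd_int_small)
  obtain U V where UV: "c (int k - 1) # v @ ?p = U @ c (int k) # V"
    using gauss_word_Cons_split[OF gr] .
  have "c (int k) \<in> set (c (int k - 1) # v @ ?p)" unfolding UV by simp
  then have "c (int k) \<in> set v" using cp kk by auto
  then obtain v1 v2 where v: "v = v1 @ c (int k) # v2" by (metis split_list)
  have r: "?r = c (int k) # (c (int k - 1) # v1) @ c (int k) # (v2 @ ?p)" by (simp add: v)
  note sa = short_arc[OF ccr[unfolded r] gr[unfolded r] refl]
  have "c (int k - 1) # v1 \<in> {[c (int k - 1), c (int k + 1)], [c (int k + 1), c (int k - 1)]}"
  proof (cases "m = 3")
    case True
    then show ?thesis by (rule sa(2))
  next
    case False
    show ?thesis using sa(1)
    proof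
      \<comment> \<open>The opposite arc contains a prefix of length \<open>2 * k\<close>, so it is
        short only if \<open>k = 1\<close> and \<open>v2\<close> is empty. It is then
        \<open>[c 0, c (- 1)]\<close>, and comparison with the neighbours of \<open>c 1\<close>
        forces \<open>m = 3\<close>.\<close>
      assume a: "v2 @ ?p \<in> {[c (int k - 1), c (int k + 1)], [c (int k + 1), c (int k - 1)]}"
      moreover have "length l = 2" if "l \<in> {[s, t], [t, s]}" for l and s t :: nat
        using that by auto
      ultimately have "length (v2 @ ?p) = 2" by blast
      then have "length v2 + 2 * k = 2" by (simp add: length_ring_word)
      then have "k = 1" "length v2 = 0" using k by linarith+
      then have "k = 1" "v2 = []" by simp_all
      then have "[c 0, c (- 1)] \<in> {[c 0, c 2], [c 2, c 0]}"
        using a by (simp add: ring_word_def)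
      then have "c (- 1) = c 2 \<or> c 0 = c 2" by auto
      then have "int m dvd 3 \<or> int m dvd 2" by (auto simp: f(2))
      then show ?thesis using False f(1) by (auto simp: dvd_int_small)
    qed
  qed
  then have "v1 = [c (int k + 1)]" using kk(2) by auto
  then show ?thesis by (simp add: v add.commute)
qed

lemma rotation_swap:
  assumes "w = p @ q" "q @ p = s @ t"
  shows "\<exists>p' q'. w = p' @ q' \<and> q' @ p' = t @ s"
proof -
  have "t @ s = rotate (length s) (rotate (length p) w)"
    by (simp only: assms rotate_append)
  then have "t @ s = rotate (length s + length p) w" by (simp only: rotate_rotate)
  then show ?thesis
    by (metis append_take_drop_id rotate_drop_take)
qed

text \<open>The order of the two neighbours on the short arc of \<open>c 0\<close> decides between
  \<open>c\<close> and its reflection. From there every further pair is forced, and the length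
  \<open>2 * m\<close> leaves no room after \<open>m\<close> pairs.\<close>

lemma ring_word_rotation:
  assumes cc: "cyclic_crossing w c m" and g: "gauss_word w"
  shows "\<exists>p q. w = p @ q \<and> (q @ p = ring_word c m \<or> q @ p = ring_word (c \<circ> uminus) m)"
proof -
  note f = cc_facts[OF cc]
  have extend: "\<exists>p q v. w = p @ q \<and> q @ p = ring_word c' (Suc k) @ v"
    if "cyclic_crossing w c' m" "1 \<le> k" "k < m" "\<exists>p q v. w = p @ q \<and> q @ p = ring_word c' 2 @ v" for c' k
    using that(2,3)
  proof (induction k rule: dec_induct)
    case base
    then show ?case using that(4) by (simp add: numeral_2_eq_2)
  next
    case (step k)
    then obtain p q v where w: "w = p @ q" "q @ p = ring_word c' (Suc k) @ v" by auto
    have "gauss_word (q @ p)" "crossing (q @ p) = crossing w" "set (q @ p) = set w"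
      using g gauss_word_rot w(1) crossing_rot by auto
    then have "\<exists>v'. v = c' (int (Suc k)) # c' (int k) # v'"
      using ring_word_prefix[of c' k v m] cyclic_crossing_cong[OF that(1)] step.prems step.hyps
      unfolding w(2) by auto
    then have "\<exists>v'. q @ p = ring_word c' (Suc (Suc k)) @ v'"
      unfolding w(2) ring_word_Suc[of c' "Suc k"] by auto
    then show ?case using w(1) by blast
  qed
  have full: "\<exists>p q. w = p @ q \<and> q @ p = ring_word c' m"
    if c': "cyclic_crossing w c' m" and s: "\<exists>p q v. w = p @ q \<and> q @ p = ring_word c' 2 @ v" for c'
  proof -
    have "1 \<le> m - 1" "m - 1 < m" "Suc (m - 1) = m" using f(1) by linarith+
    then obtain p q v where w: "w = p @ q" "q @ p = ring_word c' m @ v"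
      using extend[OF c' _ _ s, of "m - 1"] by auto
    have "length w = 2 * m"
      using gauss_word_length[OF g] card_range_cyclic[OF cc] f(3) by simp
    moreover have "length w = 2 * m + length v"
      using arg_cong[OF w(2), of length] w(1) by (simp add: length_ring_word)
    ultimately have "v = []" by simp
    then show ?thesis using w by auto
  qed
  have "c 0 \<in> set w" using f(3) by simp
  then obtain u v where uv: "w = u @ c 0 # v" by (metis split_list)
  have cr: "crossing ((c 0 # v) @ u) = crossing w" unfolding uv by (rule crossing_rot)
  have g0: "gauss_word ((c 0 # v) @ u)" using g gauss_word_rot uv by blast
  then obtain U V where UV: "v @ u = U @ c 0 # V"
    using gauss_word_Cons_split[of "c 0" "v @ u"] by (metis append_Cons)
  have eq: "(c 0 # v) @ u = c 0 # U @ c 0 # V" by (simp add: UV)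
  have cc0: "cyclic_crossing (c 0 # U @ c 0 # V) c m"
    by (rule cyclic_crossing_cong[OF cc]) (use cr uv eq in \<open>auto simp flip: eq\<close>)
  have rot1: "\<exists>p q. w = p @ q \<and> q @ p = c 0 # U @ c 0 # V" using uv eq by blast
  have rot2: "\<exists>p q. w = p @ q \<and> q @ p = c 0 # V @ c 0 # U"
    using rotation_swap[of w u "c 0 # v" "c 0 # U" "c 0 # V"] uv eq by simp
  have start: "\<exists>p q. w = p @ q \<and> q @ p = c 0 # A @ c 0 # B \<Longrightarrow>
      A \<in> {[c (0 - 1), c (0 + 1)], [c (0 + 1), c (0 - 1)]} \<Longrightarrow> ?thesis" for A B
  proof -
    assume w: "\<exists>p q. w = p @ q \<and> q @ p = c 0 # A @ c 0 # B"
      and "A \<in> {[c (0 - 1), c (0 + 1)], [c (0 + 1), c (0 - 1)]}"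
    then consider "A = [c (- 1), c 1]" | "A = [c 1, c (- 1)]" by auto
    then show ?thesis
    proof cases
      case 1
      then have "c 0 # A @ c 0 # B = ring_word c 2 @ B" by (simp add: ring_word_def upt_rec)
      then show ?thesis using full[OF cc] w by metis
    next
      case 2
      then have "c 0 # A @ c 0 # B = ring_word (c \<circ> uminus) 2 @ B" by (simp add: ring_word_def upt_rec)
      then show ?thesis using full[OF cyclic_crossing_reflect[OF cc]] w by metis
    qed
  qed
  show ?thesis
    using short_arc(1)[OF cc0 g0[unfolded eq] refl] start[OF rot1] start[OF rot2] by blast
qed

lemma ring_word_adjacent:
  assumes "cyclic_crossing w c m"
  shows "\<exists>p q. ring_word c m = p @ [c i, c (i - 1)] @ q"
proof -
  note f = cc_facts[OF assms]
  define j where "j = nat (i mod int m)"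
  have j: "j < m" "int j = i mod int m" using f(1) by (auto simp: j_def nat_less_iff)
  have "[0..<m] = [0..<j] @ j # [Suc j..<m]" using j(1) by (metis upt_conv_Cons upt_add_eq_append le0 le_add_diff_inverse less_imp_le)
  moreover have "c (int j) = c i" "c (int j - 1) = c (i - 1)"
    unfolding f(2) j(2) by (simp_all add: mod_eq_dvd_iff[symmetric])
  ultimately have "ring_word c m = concat (map (\<lambda>i. [c (int i), c (int i - 1)]) [0..<j])
      @ [c i, c (i - 1)] @ concat (map (\<lambda>i. [c (int i), c (int i - 1)]) [Suc j..<m])"
    by (simp add: ring_word_def)
  then show ?thesis by blast
qed

section \<open>Dependence on the intersection graph only\<close>

text \<open>Exchanging two adjacent ends changes only the restriction of the word to
  \<open>{a, b}\<close>, where it toggles the alternation.\<close>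

lemma crossing_swap_adjacent:
  assumes "gauss_word (a # b # S)" "a \<noteq> b"
  shows "crossing (b # a # S) x y \<longleftrightarrow>
    (if {x, y} = {a, b} then \<not> crossing (a # b # S) x y else crossing (a # b # S) x y)"
proof (cases "{x, y} = {a, b}")
  case True
  have "count_list (a # b # S) e = 2" if "e \<in> {a, b}" for e
    using assms(1) that by (auto simp: gauss_word_def)
  from this[of a] this[of b] have "count_list S a = 1" "count_list S b = 1" using assms(2) by auto
  then have "mset (filter (\<lambda>e. e \<in> {a, b}) S) = {#a, b#}"
    using assms(2) by (intro multiset_eqI) (auto simp: count_list_mset)
  then have "filter (\<lambda>e. e \<in> {a, b}) S = [a, b] \<or> filter (\<lambda>e. e \<in> {a, b}) S = [b, a]"
    by (rule mset_pair)
  then have "crossing (b # a # S) a b \<longleftrightarrow> \<not> crossing (a # b # S) a b"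
    using assms(2) by (auto simp: crossing_def)
  then show ?thesis using True by (auto simp: doubleton_eq_iff crossing_commute[of _ b a])
next
  case False
  show ?thesis
  proof (cases "x = y")
    case True
    then show ?thesis using False by (simp add: crossing_def)
  next
    case neq: False
    then have "\<not> (a \<in> {x, y} \<and> b \<in> {x, y})" using False assms(2) by auto
    then have "filter (\<lambda>e. e \<in> {x, y}) (b # a # S) = filter (\<lambda>e. e \<in> {x, y}) (a # b # S)" by auto
    then show ?thesis using False by (simp only: crossing_def if_False)
  qed
qed

lemma gauss_word_rotate_to:
  assumes "gauss_word w" "x \<in> set w"
  shows "\<exists>p q U V. w = p @ q \<and> q @ p = x # U @ x # V"
proof -
  obtain p r where w: "w = p @ x # r" using assms(2) by (metis split_list)
  then have "gauss_word (x # r @ p)" using assms(1) gauss_word_rot[of p "x # r"] by simp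
  then obtain U V where "r @ p = U @ x # V" by (rule gauss_word_Cons_split)
  then have "w = p @ (x # r) \<and> (x # r) @ p = x # U @ x # V" using w by simp
  then show ?thesis by blast
qed

context four_term_function
begin

text \<open>The chord \<open>c 0\<close>, which alone may be decorated, is fixed by the relabelling
  of \<open>c j\<close> as \<open>c (- j)\<close>, and this relabelling yields the mirror
  image.\<close>

lemma val_ring_reflect:
  assumes cc: "cyclic_crossing (ring_word c m) c m"
    and g: "gauss_word (ring_word c m)" "gauss_word (ring_word (c \<circ> uminus) m)"
    and d: "\<And>j. c j \<noteq> c 0 \<Longrightarrow> d (c j) = ([], [])"
  shows "val d z (ring_word c m) = val d z (ring_word (c \<circ> uminus) m)"
proof -
  note f = cc_facts[OF cc]
  have m: "0 < m" using f(1) by simp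
  \<comment> \<open>The index of a chord is determined only modulo \<open>m\<close>, hence the
    choice; negation respects the congruence. Letters outside the ring, such as those of branches,
    stay fixed.\<close>
  define h where "h u = (if u \<in> range c then c (- (SOME j. c j = u)) else u)" for u
  have h: "h (c j) = c (- j)" for j
  proof -
    have "c (SOME i. c i = c j) = c j" by (rule someI) (rule refl)
    then have "int m dvd (SOME i. c i = c j) - j" by (simp add: f(2))
    then have "c (- (SOME i. c i = c j)) = c (- j)"
      unfolding f(2) by (simp add: dvd_diff_commute)
    then show ?thesis by (simp add: h_def)
  qed
  have h_off: "h u = u" if "u \<notin> range c" for u using that by (simp add: h_def)
  have "h (h u) = u" for u by (cases "u \<in> range c") (auto simp: h h_off)
  then have inj: "inj h" by (metis injI)
  have hring: "map h (ring_word c m) = ring_word (c \<circ> uminus) m"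
    unfolding map_ring_word by (rule arg_cong[of _ _ "\<lambda>c. ring_word c m"]) (simp add: fun_eq_iff h)
  obtain u where u: "ring_word c m = c 0 # u"
    using m by (cases m) (simp_all add: ring_word_def upt_conv_Cons del: upt_Suc)
  then have u': "ring_word (c \<circ> uminus) m = c 0 # map h u" using hring h[of 0] by auto
  have setu: "set u \<subseteq> range c" using u f(3) by auto
  have triv: "decorate d {c 0} v = v" if "set v \<subseteq> range c" for v
    by (rule decorate_trivial) (use that d in auto)
  have "set (map h u) \<subseteq> range c" using setu h by auto
  then have v: "val d z (ring_word c m) = f (fst (d (c 0)) @ c 0 # snd (d (c 0)) @ u @ z)"
    "val d z (ring_word (c \<circ> uminus) m) = f (fst (d (c 0)) @ c 0 # snd (d (c 0)) @ map h u @ z)"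
    by (simp_all add: val_def u u' triv setu)
  have "mset (ring_word c m) = mset (ring_word (c \<circ> uminus) m)"
  proof (rule multiset_eqI)
    fix a
    have "c j \<in> h ` range c" for j using h[of "- j"] by (metis imageI minus_minus rangeI)
    then have "h ` range c = range c" using h by auto
    then have "set (ring_word (c \<circ> uminus) m) = set (ring_word c m)"
      by (simp only: hring[symmetric] set_map f(3))
    then show "count (mset (ring_word c m)) a = count (mset (ring_word (c \<circ> uminus) m)) a"
      using g unfolding gauss_word_def count_list_mset[symmetric] by (metis count_list_0_iff)
  qed
  then have ms: "mset u = mset (map h u)" using u u' by simp
  show ?thesis unfolding v
  proof (rule eq_if_gauss)
    let ?L = "fst (d (c 0)) @ c 0 # snd (d (c 0)) @ u @ z"
    assume gL: "gauss_word ?L"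
    have "set (ring_word c m) \<inter> set (fst (d (c 0)) @ snd (d (c 0)) @ z) = {}"
      by (rule gauss_word_appendD(1)[OF gL _ gauss_word_imp_even_word[OF g(1)]]) (simp add: u)
    then have "map h (fst (d (c 0))) = fst (d (c 0))" "map h (snd (d (c 0))) = snd (d (c 0))" "map h z = z"
      using f(3) by (auto intro!: map_idI h_off)
    then have "map h ?L = fst (d (c 0)) @ c 0 # snd (d (c 0)) @ map h u @ z"
      using h[of 0] by simp
    then show "f ?L = f (fst (d (c 0)) @ c 0 # snd (d (c 0)) @ map h u @ z)"
      using rename[of h ?L] inj by (metis inj_on_subset subset_UNIV)
  qed (simp only: mset_append mset.simps ms)
qed

text \<open>Moving the branches from \<open>c i\<close> to \<open>c (i - 1)\<close> keeps the
  difference of the two values, because uncrossing these chords in both words gives words with the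
  same forest as graph. Doing this for \<open>i = m - 1, ..., 1\<close> collects everything on
  \<open>c 0\<close>.\<close>

lemma val_eq_ring:
  fixes c :: "int \<Rightarrow> nat" and m :: nat
  defines "w \<equiv> ring_word c m" and "w' \<equiv> ring_word (c \<circ> uminus) m"
  assumes g: "gauss_word w" "gauss_word w'" and cc: "cyclic_crossing w c m"
    and set: "set w' = set w" and cr: "crossing w' = crossing w"
    and cyc: "\<And>vs a b. cycle_list (crossing w) vs \<Longrightarrow> set vs \<subseteq> set w \<Longrightarrow> crossing w a b
      \<Longrightarrow> {a, b} \<in> closed_walk_edges vs"
    and forest: "\<And>u u' d. gauss_word u \<Longrightarrow> gauss_word u' \<Longrightarrow> set u = set w \<Longrightarrow> set u' = set w
      \<Longrightarrow> crossing u = crossing u' \<Longrightarrow> acyclic_on (crossing u) (set w) \<Longrightarrow> branch_decoration d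
      \<Longrightarrow> val d z u = val d z u'"
    and z: "even_word z" and d: "branch_decoration d"
  shows "val d z w = val d z w'"
proof -
  note f = cc_facts[OF cc]
  have cc': "cyclic_crossing w' (c \<circ> uminus) m"
    by (rule cyclic_crossing_cong[OF cyclic_crossing_reflect[OF cc] cr set])
  have shift: "val d z w - val d z w' = val d' z w - val d' z w'"
    if d: "branch_decoration d" and d': "d' = d(b := ([], []), a := (fst (d b) @ fst (d a), snd (d a) @ snd (d b)))"
      and ab: "a = c (i - 1)" "b = c i" for d d' a b i
  proof -
    have bd': "branch_decoration d'"
      unfolding d' by (intro branch_decoration_upd d branches.intros branch_decorationD)
    have "a \<noteq> b" using f(1) by (simp add: ab f(2) dvd_int_small)
    obtain p q where w: "w = p @ [b, a] @ q"
      using ring_word_adjacent[OF cc, of i] unfolding w_def ab by blast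
    \<comment> \<open>In the reflected ring the same two chords form the pair with index
      \<open>1 - i\<close>, in the opposite order.\<close>
    obtain p' q' where w': "w' = p' @ [a, b] @ q'"
      using ring_word_adjacent[OF cc', of "1 - i"] unfolding w'_def ab by auto
    define S S' where "S = q @ p" and "S' = q' @ p'"
    have rw: "(([b, a] @ q) @ p) = b # a # S" "(([a, b] @ q') @ p') = a # b # S'"
      by (simp_all add: S_def S'_def)
    have gS: "gauss_word (b # a # S)" using gauss_word_rot[of p "[b, a] @ q"] g(1) w rw by simp
    have gS': "gauss_word (a # b # S')" using gauss_word_rot[of p' "[a, b] @ q'"] g(2) w' rw by simp
    have gu: "gauss_word (a # b # S)" using gauss_word_mset_cong[of "b # a # S" "a # b # S"] gS by simp
    have gu': "gauss_word (b # a # S')" using gauss_word_mset_cong[of "b # a # S'" "a # b # S'"] gS' by simp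
    have crS: "crossing (b # a # S) = crossing w" "crossing (a # b # S') = crossing w"
      using crossing_rot[of p "[b, a] @ q"] crossing_rot[of p' "[a, b] @ q'"] w w' rw cr by simp_all
    have cab: "crossing w a b" by (simp add: ab f(4))
    have cru: "crossing (a # b # S) x y \<longleftrightarrow> crossing w x y \<and> {x, y} \<noteq> {a, b}"
      "crossing (b # a # S') x y \<longleftrightarrow> crossing w x y \<and> {x, y} \<noteq> {a, b}" for x y
      using crossing_swap_adjacent[OF gS, of x y] crossing_swap_adjacent[OF gS', of x y] crS cab \<open>a \<noteq> b\<close>
      by (auto simp: doubleton_eq_iff crossing_commute[of _ b a])
    have sets: "set (a # b # S) = set w" "set (b # a # S') = set w"
      using w w' set by (auto simp: S_def S'_def)
    \<comment> \<open>Every cycle of \<open>w\<close> uses the edge \<open>{a, b}\<close>, which has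
      just been removed.\<close>
    have ac: "acyclic_on (crossing (a # b # S)) (set w)"
      unfolding acyclic_on_def
    proof (intro allI impI notI)
      fix vs assume vs: "cycle_list (crossing (a # b # S)) vs" "set vs \<subseteq> set w"
      have "cycle_list (crossing w) vs" by (rule cycle_list_mono[OF vs(1)]) (simp add: cru)
      then have "{a, b} \<in> closed_walk_edges vs" using cyc vs(2) cab by blast
      then have "crossing (a # b # S) a b" by (rule cycle_list_edge[OF vs(1) symp_crossing])
      then show False by (simp add: cru)
    qed
    have fr: "val e z (a # b # S) = val e z (b # a # S')" if "branch_decoration e" for e
      by (rule forest[OF gu gu' sets _ ac that]) (simp add: fun_eq_iff cru)
    have rv: "val e z w = val e z (b # a # S)" "val e z w' = val e z (a # b # S')" if "branch_decoration e" for e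
      using val_rot[OF that z, of p "[b, a] @ q"] val_rot[OF that z, of p' "[a, b] @ q'"] g w w' rw by simp_all
    have 1: "val d z (a # b # S) - val d z (b # a # S) = val d' z (a # b # S) - val d' z (b # a # S)"
      unfolding d' by (rule val_through_vertex[OF d gu \<open>a \<noteq> b\<close>])
    have 2: "val d z (a # b # S') - val d z (b # a # S') = val d' z (a # b # S') - val d' z (b # a # S')"
      unfolding d' by (rule val_through_vertex[OF d gS' \<open>a \<noteq> b\<close>])
    \<comment> \<open>\<open>u\<close> stands for the common value of the two uncrossed words, which
      agree by \<open>fr\<close>.\<close>
    have alg: "y - x = y' - x'" if "u - x = u' - x'" "y - u = y' - u'" for x y u x' y' u' :: 'k
    proof -
      have "y - x = (y - u) + (u - x)" by simp
      also have "\<dots> = (y' - u') + (u' - x')" by (simp only: that)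
      finally show ?thesis by simp
    qed
    have "val d z w' - val d z w = val d' z w' - val d' z w"
      unfolding rv[OF d] rv[OF bd'] using alg[OF 1] 2 fr[OF d] fr[OF bd'] by simp
    then show ?thesis by (metis minus_diff_eq)
  qed
  have "val d z w = val d z w'"
    if "branch_decoration d" "k < m" "\<And>j. k < j \<Longrightarrow> j < m \<Longrightarrow> d (c (int j)) = ([], [])" for k d
    using that
  proof (induction k arbitrary: d)
    case 0
    have "d (c i) = ([], [])" if "c i \<noteq> c 0" for i
    proof -
      obtain j where j: "j < m" "c i = c (int j)" using cc_index[OF cc, of i 0] by auto
      then have "j \<noteq> 0" using that by (intro notI) simp
      then show ?thesis using 0(3)[of j] j by simp
    qed
    then show ?case using val_ring_reflect[of c m d z] cc g unfolding w_def w'_def by blast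
  next
    case (Suc k)
    define a b where "a = c (int k)" and "b = c (int (Suc k))"
    define d' where "d' = d(b := ([], []), a := (fst (d b) @ fst (d a), snd (d a) @ snd (d b)))"
    have "val d z w - val d z w' = val d' z w - val d' z w'"
      by (rule shift[OF Suc.prems(1) d'_def, of "int (Suc k)"]) (simp_all add: a_def b_def)
    moreover have "val d' z w = val d' z w'"
    proof (rule Suc.IH)
      show "branch_decoration d'"
        unfolding d'_def by (intro branch_decoration_upd Suc.prems branches.intros branch_decorationD)
      show "k < m" using Suc.prems(2) by simp
      fix j assume j: "k < j" "j < m"
      then have "c (int j) \<noteq> a" by (simp add: a_def f(2) dvd_int_small)
      moreover have "c (int j) \<noteq> b \<Longrightarrow> Suc k < j" using j by (cases "j = Suc k") (auto simp: b_def)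
      ultimately show "d' (c (int j)) = ([], [])"
        using Suc.prems(3)[of j] j by (auto simp: d'_def)
    qed
    ultimately show ?case by simp
  qed
  from this[of d "m - 1"] show ?thesis using d f(1) by auto
qed

end

section \<open>From cycles of the graph to cyclic lists of chords\<close>

lemma cycle_list_imp_cycles:
  assumes "cycle_list (crossing w) vs" "set vs \<subseteq> set w"
  shows "closed_walk_edges vs \<in> cycles (word_graph w)"
proof -
  have "closed_walk_edges vs \<subseteq> snd (word_graph w)"
    using cycle_list_nth[OF assms(1)] by (auto simp: closed_walk_edges_def edge_word_graph)
  then show ?thesis
    using assms unfolding cycles_def cycle_list_def by (auto simp: word_graph_def)
qed

lemma at_most_one_cycle_imp_unicyclic:
  "at_most_one_cycle (word_graph w) \<Longrightarrow> unicyclic_on (crossing w) (set w)"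
  unfolding at_most_one_cycle_def unicyclic_on_def using cycle_list_imp_cycles by blast

lemma cyclic_crossing_exists:
  assumes vs: "cycle_list (crossing w) vs" "set vs = set w"
    and edge: "\<And>u v. u \<in> set w \<Longrightarrow> v \<in> set w \<Longrightarrow> crossing w u v \<longleftrightarrow> {u, v} \<in> closed_walk_edges vs"
  shows "\<exists>c. cyclic_crossing w c (length vs)"
proof -
  define m where "m = length vs"
  define c where "c j = vs ! nat (j mod int m)" for j
  have m: "3 \<le> m" and dist: "distinct vs" using vs(1) by (simp_all add: cycle_list_def m_def)
  have lt: "nat (j mod int m) < m" for j using m by (simp add: nat_less_iff)
  have mem: "c j \<in> set w" for j using lt[of j] by (simp add: c_def vs(2)[symmetric] m_def)
  have eq: "c a = c b \<longleftrightarrow> int m dvd a - b" for a b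
  proof -
    have "0 \<le> a mod int m" "0 \<le> b mod int m" using m by simp_all
    then show ?thesis
      using lt[of a] lt[of b] dist
      by (simp add: c_def m_def[symmetric] nth_eq_iff_index_eq mod_eq_dvd_iff[symmetric] eq_nat_nat_iff)
  qed
  have nth: "vs ! i = c (int i)" if "i < m" for i using that by (simp add: c_def)
  have suc: "vs ! (Suc i mod m) = c (int i + 1)" for i
  proof -
    have "(int i + 1) mod int m = int (Suc i mod m)" by (simp add: zmod_int add.commute)
    then show ?thesis by (simp add: c_def)
  qed
  have "range c = set vs"
  proof
    show "range c \<subseteq> set vs" using mem vs(2) by auto
    show "set vs \<subseteq> range c"
      using nth by (metis in_set_conv_nth m_def rangeI subsetI)
  qed
  moreover have "crossing w (c a) (c b) \<longleftrightarrow> int m dvd a - b - 1 \<or> int m dvd b - a - 1" for a b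
  proof
    assume "crossing w (c a) (c b)"
    then have "{c a, c b} \<in> closed_walk_edges vs" using edge mem by blast
    then obtain i where "i < m" "{c a, c b} = {c (int i), c (int i + 1)}"
      using nth suc by (auto simp: closed_walk_edges_def m_def)
    then have "int m dvd a - int i \<and> int m dvd b - (int i + 1) \<or> int m dvd a - (int i + 1) \<and> int m dvd b - int i"
      by (auto simp: doubleton_eq_iff eq)
    then show "int m dvd a - b - 1 \<or> int m dvd b - a - 1"
      using dvd_diff[of "int m" "a - (int i + 1)" "b - int i"] dvd_diff[of "int m" "b - (int i + 1)" "a - int i"]
      by (auto simp: algebra_simps)
  next
    have e: "crossing w (c a) (c b)" if "int m dvd b - a - 1" for a b
    proof -
      let ?i = "nat (a mod int m)"
      have "c a = c (int ?i)" "c b = c (int ?i + 1)"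
        using that m unfolding eq by (auto simp: mod_eq_dvd_iff[symmetric] algebra_simps mod_simps)
      then have "{c a, c b} = {vs ! ?i, vs ! (Suc ?i mod m)}" using nth[OF lt[of a]] suc[of ?i] by simp
      then have "{c a, c b} \<in> closed_walk_edges vs"
        using lt[of a] by (auto simp: closed_walk_edges_def m_def)
      then show ?thesis using edge mem by blast
    qed
    assume "int m dvd a - b - 1 \<or> int m dvd b - a - 1"
    then show "crossing w (c a) (c b)"
      using e[of b a] e[of a b] by (auto simp: crossing_commute)
  qed
  ultimately have "cyclic_crossing w c m"
    using m eq vs(2) by (simp add: cyclic_crossing_def)
  then show ?thesis by (auto simp: m_def)
qed

context four_term_function
begin

text \<open>Non-branching chords are removed from both words simultaneously: the graph prescribes
  the same graft, or the same part to split off, on both sides.\<close>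

theorem val_unique:
  assumes "gauss_word w" "gauss_word w'" "set w' = set w" "crossing w' = crossing w"
    and "unicyclic_on (crossing w) (set w)" "branch_decoration d" "even_word z"
  shows "val d z w = val d z w'"
  using assms
\<comment> \<open>The summand 1 lets the case of a cycle appeal to forests on the same chords; the
  factor 2 makes the removal of a chord decrease the measure whatever this summand does.\<close>
proof (induction "2 * card (set w) + (if acyclic_on (crossing w) (set w) then 0 else 1 :: nat)"
    arbitrary: w w' d z rule: less_induct)
  case less
  note g = less.prems(1,2) and set = less.prems(3) and cr = less.prems(4) and uni = less.prems(5)
    and d = less.prems(6) and z = less.prems(7)
  show ?case
  proof (cases "\<exists>x\<in>set w. \<not> branching (crossing w) (set w) x")
    case True
    then obtain x where x: "x \<in> set w" "\<not> branching (crossing w) (set w) x" by blast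
    obtain p q U V where w: "w = p @ q" "q @ p = x # U @ x # V"
      using gauss_word_rotate_to[OF g(1) x(1)] by blast
    obtain p' q' U' V' where w': "w' = p' @ q'" "q' @ p' = x # U' @ x # V'"
      using gauss_word_rotate_to[OF g(2)] x(1) set by blast
    have g1: "gauss_word (x # U @ x # V)" "gauss_word (x # U' @ x # V')"
      using g gauss_word_rot w w' by metis+
    have cr1: "crossing (x # U @ x # V) = crossing w" "crossing (x # U' @ x # V') = crossing w"
      using crossing_rot w w' cr by metis+
    have set1: "set (x # U @ x # V) = set w" "set (x # U' @ x # V') = set w"
      using w w' set by (metis set_append Un_commute)+
    have rv: "val d z w = val d z (x # U @ x # V)" "val d z w' = val d z (x # U' @ x # V')"
      using val_rot[OF d z] g w w' by metis+
    have x1: "x \<notin> set (U @ V)" "x \<notin> set (U' @ V')"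
      using gauss_word_two[of "[]" x U V] gauss_word_two[of "[]" x U' V'] g1 by auto
    have nb: "b \<in> set U \<inter> set V \<longleftrightarrow> crossing w x b" "b \<in> set U' \<inter> set V' \<longleftrightarrow> crossing w x b" for b
      using crossing_chord[OF g1(1), of b] crossing_chord[OF g1(2), of b] cr1 by simp_all
    then have UV: "set U' \<inter> set V' = set U \<inter> set V" by blast
    have set2: "set (U @ V) = set w - {x}" "set (U' @ V') = set w - {x}" using set1 x1 by auto
    have cr2: "crossing (U' @ V') = crossing (U @ V)"
      using crossing_remove[OF g1(1)] crossing_remove[OF g1(2)] cr1 by (simp add: fun_eq_iff)
    have g2: "gauss_word (U @ V)" "gauss_word (U' @ V')" using gauss_word_remove g1 by blast+
    have uni2: "unicyclic_on (crossing (U @ V)) (set (U @ V))"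
      by (rule unicyclic_on_mono[OF uni]) (use crossing_remove[OF g1(1)] cr1 set2 in auto)
    have "card (set (U @ V)) < card (set w)"
      unfolding set2 by (rule card_Diff1_less) (simp_all add: x(1))
    then have IH: "val e y (U @ V) = val e y (U' @ V')" if "branch_decoration e" "even_word y" for e y
      using less.hyps[of "U @ V" "U' @ V'" e y] that g2 set2 cr2 uni2 by simp
    show ?thesis
    proof (cases "set U \<inter> set V = {}")
      case True
      then show ?thesis
        unfolding rv using val_isolated[OF d z g1(1)] val_isolated[OF d z g1(2)] UV IH[OF d] by simp
    next
      case False
      then obtain a where a: "a \<in> set U \<inter> set V" by blast
      have "b = a" if "b \<in> set U \<inter> set V" for b
      proof -
        have "crossing w x a" "crossing w x b" using nb(1) a that by blast+
        moreover from this have "a \<in> set w" "b \<in> set w" by (auto dest: crossing_in_set)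
        ultimately show ?thesis using x(2) unfolding branching_def by blast
      qed
      then have "set U \<inter> set V = {a}" using a by blast
      then show ?thesis
        unfolding rv using val_leaf_unicyclic[OF g1(1) _ _ d z, of a] val_leaf_unicyclic[OF g1(2) _ _ d z, of a]
          UV uni cr1 set1 IH[OF branch_decoration_graft[OF d] z] by simp
    qed
  next
    case False
    show ?thesis
    proof (cases "set w = {}")
      case True
      then show ?thesis using set by simp
    next
      case nonempty: False
      obtain vs where vs: "cycle_list (crossing w) vs" "set vs = set w"
        and edge: "\<forall>u\<in>set w. \<forall>v\<in>set w. crossing w u v \<longleftrightarrow> {u, v} \<in> closed_walk_edges vs"
        using unicyclic_branching_is_cycle[OF symp_crossing irreflp_crossing finite_set nonempty uni] False
        by blast
      then obtain c m where cc: "cyclic_crossing w c m" using cyclic_crossing_exists[OF vs] by blast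
      have cyclic: "\<not> acyclic_on (crossing w) (set w)" using vs by (auto simp: acyclic_on_def)
      have forest: "val d z u = val d z u'"
        if "gauss_word u" "gauss_word u'" "set u = set w" "set u' = set w" "crossing u = crossing u'"
          "acyclic_on (crossing u) (set w)" "branch_decoration d" for u u' d
      proof -
        have "unicyclic_on (crossing u) (set u)"
          using that(3,6) unfolding unicyclic_on_def acyclic_on_def by metis
        moreover have "acyclic_on (crossing u) (set u)" using that(3,6) by simp
        ultimately show ?thesis
          using that cyclic z by (intro less.hyps) simp_all
      qed
      have edges: "{a, b} \<in> closed_walk_edges us"
        if "cycle_list (crossing w) us" "set us \<subseteq> set w" "crossing w a b" for us a b
      proof -
        have "closed_walk_edges us = closed_walk_edges vs"
          by (rule unicyclic_on_vertices(1)[OF uni that(1,2) vs(1)]) (simp add: vs(2))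
        moreover have "{a, b} \<in> closed_walk_edges vs"
          using edge crossing_in_set[OF that(3)] that(3) by blast
        ultimately show ?thesis by simp
      qed
      have ring: "val d z u = val d z u'"
        if c: "cyclic_crossing w c m" and u: "u = p @ q" "q @ p = ring_word c m" "gauss_word u" "set u = set w" "crossing u = crossing w"
          and u': "u' = p' @ q'" "q' @ p' = ring_word (c \<circ> uminus) m" "gauss_word u'" "set u' = set w" "crossing u' = crossing w"
        for c u u' p q p' q'
      proof -
        have G: "gauss_word (ring_word c m)" "gauss_word (ring_word (c \<circ> uminus) m)"
          using u u' gauss_word_rot by metis+
        have S: "set (ring_word c m) = set w" "set (ring_word (c \<circ> uminus) m) = set w"
          using u u' by (metis set_append Un_commute)+
        have C: "crossing (ring_word c m) = crossing w" "crossing (ring_word (c \<circ> uminus) m) = crossing w"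
          using u u' crossing_rot by metis+
        have "val d z (ring_word c m) = val d z (ring_word (c \<circ> uminus) m)"
        proof (rule val_eq_ring[OF G cyclic_crossing_cong[OF c C(1) S(1)] _ _ _ _ z d])
          show "set (ring_word (c \<circ> uminus) m) = set (ring_word c m)" by (simp only: S)
          show "crossing (ring_word (c \<circ> uminus) m) = crossing (ring_word c m)" by (simp only: C)
          show "{a, b} \<in> closed_walk_edges us"
            if "cycle_list (crossing (ring_word c m)) us" "set us \<subseteq> set (ring_word c m)"
              "crossing (ring_word c m) a b" for us a b
            using that unfolding S C by (rule edges)
          show "val d z u = val d z u'"
            if "gauss_word u" "gauss_word u'" "set u = set (ring_word c m)"
              "set u' = set (ring_word c m)" "crossing u = crossing u'"
              "acyclic_on (crossing u) (set (ring_word c m))" "branch_decoration d" for u u' d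
            using that unfolding S by (rule forest)
        qed
        moreover have "val d z u = val d z (ring_word c m)" "val d z u' = val d z (ring_word (c \<circ> uminus) m)"
          using val_rot[OF d z] u u' by metis+
        ultimately show ?thesis by simp
      qed
      obtain p q where pq: "w = p @ q" "q @ p = ring_word c m \<or> q @ p = ring_word (c \<circ> uminus) m"
        using ring_word_rotation[OF cc g(1)] by blast
      obtain p' q' where pq': "w' = p' @ q'" "q' @ p' = ring_word c m \<or> q' @ p' = ring_word (c \<circ> uminus) m"
        using ring_word_rotation[OF cyclic_crossing_cong[OF cc cr set] g(2)] by blast
      show ?thesis
      proof (cases "q @ p = q' @ p'")
        case True
        have "val d z w = val d z (q @ p)" "val d z w' = val d z (q' @ p')"
          using val_rot[OF d z] g pq pq' by metis+
        then show ?thesis using True by simp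
      next
        case False
        then consider "q @ p = ring_word c m" "q' @ p' = ring_word (c \<circ> uminus) m"
          | "q' @ p' = ring_word c m" "q @ p = ring_word (c \<circ> uminus) m"
          using pq(2) pq'(2) by metis
        then show ?thesis
        proof cases
          case 1
          show ?thesis by (rule ring[OF cc pq(1) 1(1) g(1) refl refl pq'(1) 1(2) g(2) set cr])
        next
          case 2
          show ?thesis by (rule ring[OF cc pq'(1) 2(1) g(2) set cr pq(1) 2(2) g(1) refl refl, symmetric])
        qed
      qed
    qed
  qed
qed

end

section \<open>Weight systems as functions on words\<close>

lemma gauss_word_some_word: "gauss_word (some_word D)"
  using Quotient3_rep_reflp[OF Quotient3_chord_diagram, of D] by (simp add: word_equiv_def)

lemma diagram_some_word: "diagram (some_word D) = D"
  by (rule Quotient3_abs_rep[OF Quotient3_chord_diagram])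

lemma diagram_eqI: "word_equiv w w' \<Longrightarrow> diagram w = diagram w'"
  by (rule Quotient3_rel_abs[OF Quotient3_chord_diagram])

lemma num_chords_some_word: "num_chords D = card (set (some_word D))"
  by (simp add: num_chords_def)

lemma gauss_word_map:
  assumes "inj_on g (set w)" shows "gauss_word (map g w) \<longleftrightarrow> gauss_word w"
  using count_list_inj_map[OF assms] by (auto simp: gauss_word_def)

text \<open>The relations for \<open>W\<close> are available in degree \<open>n\<close> only, so
  other words get the value 0. The four words of a 4-term relation have the same letters, hence are
  all kept or all sent to 0.\<close>

definition word_weight :: "nat \<Rightarrow> ((chord_diagram \<Rightarrow>\<^sub>0 'k::{comm_ring, comm_monoid_mult}) \<Rightarrow> 'k) \<Rightarrow> nat list \<Rightarrow> 'k" where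
  "word_weight n W w =
    (if gauss_word w \<and> card (set w) = n then W (basis_diagram (diagram w)) else 0)"

lemma four_term_function_word_weight:
  assumes "weight_system n W"
  shows "four_term_function (word_weight n W)"
proof
  fix u v :: "nat list"
  have "word_equiv (u @ v) (v @ u)" if "gauss_word (u @ v)"
    unfolding word_equiv_def using that gauss_word_rot
    by (intro conjI exI[of _ id] exI[of _ "length u"]) (simp_all add: rotate_append)
  then show "word_weight n W (u @ v) = word_weight n W (v @ u)"
    using gauss_word_rot[of u v] gauss_word_rot[of v u] diagram_eqI[of "u @ v" "v @ u"]
    by (auto simp: word_weight_def Un_commute)
next
  fix g :: "nat \<Rightarrow> nat" and w :: "nat list" assume g: "inj_on g (set w)"
  have "word_equiv w (map g w)" if "gauss_word w"
    unfolding word_equiv_def using that g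
    by (intro conjI exI[of _ g] exI[of _ 0]) (simp_all add: gauss_word_map)
  then show "word_weight n W (map g w) = word_weight n W w"
    using diagram_eqI[of w "map g w"] by (simp add: word_weight_def gauss_word_map[OF g] card_image[OF g])
next
  fix x a :: nat and t u v :: "nat list"
  let ?w1 = "[x] @ t @ [x, a] @ u @ [a] @ v" and ?w2 = "[x] @ t @ [a, x] @ u @ [a] @ v"
    and ?w3 = "[x] @ t @ [a] @ u @ [x, a] @ v" and ?w4 = "[x] @ t @ [a] @ u @ [a, x] @ v"
    and ?z = "t @ [a] @ u @ [a] @ v"
  have m: "mset ?w2 = mset ?w1" "mset ?w3 = mset ?w1" "mset ?w4 = mset ?w1" by simp_all
  note eqs = m[THEN gauss_word_mset_cong] m[THEN mset_eq_setD]
  show "word_weight n W ?w1 - word_weight n W ?w2 + word_weight n W ?w3 - word_weight n W ?w4 = 0"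
  proof (cases "gauss_word ?w1 \<and> card (set ?w1) = n")
    case True
    then have g: "gauss_word ?w1" by blast
    have e: "mset ?w1 = mset ([x, x] @ ?z)" "even_word [x, x]" by (simp_all add: even_word_def)
    have z: "x \<notin> set ?z" "gauss_word ?z"
      using gauss_word_appendD(1,3)[OF g e] by auto
    have "set ?w1 = insert x (set ?z)" by auto
    then have "Suc (card (set ?z)) = n"
      using True card_insert_disjoint[OF finite_set z(1)] by metis
    with z have "W (basis_diagram (diagram ?w1)) - W (basis_diagram (diagram ?w2))
        + W (basis_diagram (diagram ?w3)) - W (basis_diagram (diagram ?w4)) = 0"
      using assms unfolding weight_system_def four_term_def by blast
    then show ?thesis by (simp only: word_weight_def eqs True simp_thms if_True)
  next
    case False
    then show ?thesis by (simp only: word_weight_def eqs if_False) simp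
  qed
next
  fix w :: "nat list" assume "\<not> gauss_word w"
  then show "word_weight n W w = 0" by (simp add: word_weight_def)
qed

theorem theorem1:
  fixes W :: "(chord_diagram \<Rightarrow>\<^sub>0 'k::{comm_ring, comm_monoid_mult}) \<Rightarrow> 'k"
    and D\<^sub>1 D\<^sub>2 :: chord_diagram
    and n :: nat
  assumes "num_chords D\<^sub>1 = n"
    and "num_chords D\<^sub>2 = n"
    and "graph_iso (intersection_graph D\<^sub>1) (intersection_graph D\<^sub>2)"
    and "at_most_one_cycle (intersection_graph D\<^sub>1)"
    and "weight_system n W"
  shows "W (basis_diagram D\<^sub>1) = W (basis_diagram D\<^sub>2)"
proof -
  interpret four_term_function "word_weight n W"
    by (rule four_term_function_word_weight[OF assms(5)])
  define w1 w2 where "w1 = some_word D\<^sub>1" and "w2 = some_word D\<^sub>2"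
  have g: "gauss_word w1" "gauss_word w2" by (simp_all add: w1_def w2_def gauss_word_some_word)
  have W: "W (basis_diagram D\<^sub>1) = word_weight n W w1" "W (basis_diagram D\<^sub>2) = word_weight n W w2"
    using assms(1,2) g
    by (simp_all add: word_weight_def w1_def w2_def diagram_some_word num_chords_some_word)
  obtain h where h: "bij_betw h (set w1) (set w2)"
    and edge: "\<And>u v. u \<in> set w1 \<Longrightarrow> v \<in> set w1 \<Longrightarrow> crossing w1 u v \<longleftrightarrow> crossing w2 (h u) (h v)"
    using assms(3) unfolding graph_iso_def intersection_graph_def edge_word_graph
    by (auto simp: word_graph_def w1_def w2_def)
  define k where "k = inv_into (set w1) h"
  have k: "bij_betw k (set w2) (set w1)" unfolding k_def by (rule bij_betw_inv_into[OF h])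
  have hk: "h (k u) = u" if "u \<in> set w2" for u
    using that h unfolding k_def by (rule bij_betw_inv_into_right[rotated])
  have kh: "k (h u) = u" if "u \<in> set w1" for u
    using that h unfolding k_def by (rule bij_betw_inv_into_left[rotated])
  \<comment> \<open>Renaming along the isomorphism puts both words on the same letters with equal
    crossing relations, as \<open>val_unique\<close> requires.\<close>
  define w where "w = map k w2"
  have inj: "inj_on k (set w2)" using k by (simp add: bij_betw_def)
  have set: "set w = set w1" using k by (simp add: w_def bij_betw_def)
  have gw: "gauss_word w" using g by (simp add: w_def gauss_word_map[OF inj])
  have "map h w = w2" using hk by (auto simp: w_def intro: map_idI)
  have "inj_on h (set w)" using h set by (simp add: bij_betw_def)
  have "crossing w a b \<longleftrightarrow> crossing w1 a b" for a b
  proof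
    assume c: "crossing w a b"
    then have ab: "a \<in> set w1" "b \<in> set w1" using crossing_in_set set by auto
    have "crossing (map h w) (h a) (h b)" by (rule crossing_map_imp[OF \<open>inj_on h (set w)\<close> c])
    then show "crossing w1 a b" using edge[OF ab] \<open>map h w = w2\<close> by simp
  next
    assume c: "crossing w1 a b"
    then have ab: "a \<in> set w1" "b \<in> set w1" using crossing_in_set by auto
    then have "crossing w2 (h a) (h b)" using edge c by simp
    then have "crossing w (k (h a)) (k (h b))"
      unfolding w_def by (rule crossing_map_imp[OF inj])
    then show "crossing w a b" using kh ab by simp
  qed
  then have cr: "crossing w = crossing w1" by (simp add: fun_eq_iff)
  have "unicyclic_on (crossing w1) (set w1)"
    using assms(4) by (intro at_most_one_cycle_imp_unicyclic) (simp add: intersection_graph_def w1_def)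
  then have "val (\<lambda>_. ([], [])) [] w1 = val (\<lambda>_. ([], [])) [] w"
    by (intro val_unique g gw set cr)
      (simp_all add: branch_decoration_def branches.Nil even_word_def)
  then have "word_weight n W w1 = word_weight n W w"
    by (simp add: val_def decorate_trivial)
  also have "\<dots> = word_weight n W w2" unfolding w_def by (rule rename[OF inj])
  finally show ?thesis using W by simp
qed

end
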